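(* The sub-$C^\ast$-algebra $\mathcal{C}=C^\ast\{A_v,B_{\tilde v}\mid v\in V,\ \tilde v\in\tilde V\}$ of $\mathcal{A}$ is a regular masa for $\mathcal{A}$.
   Context: Let $\mathcal{L}$ be the infinite planar square lattice (vertex set $V=\mathbb{Z}^2$, nearest-neighbour edges), with set of unoriented edges $E$. Let $\tilde V$ be the set of faces of $\mathcal{L}$; for $\tilde v\in\tilde V$ write $e\in\tilde v$ if $e\in E$ is one of the four edges bounding the face $\tilde v$; for $v\in V$ write $e\ni v$ if $v$ is an endpoint of $e$. Each edge $e$ carries $\mathcal{A}_e=M_2(\mathbb{C})$, with Pauli matrices $\sigma^x_e,\sigma^z_e\in\mathcal{A}_e$. For finite $\Lambda\subset E$, $\mathcal{A}_\Lambda=\bigotimes_{e\in\Lambda}\mathcal{A}_e$, with the natural inclusions $\mathcal{A}_{\Lambda'}\subset\mathcal{A}_\Lambda$ for $\Lambda'\subset\Lambda$; $\mathcal{A}$ is the $C^\ast$-completion of $\bigcup_\Lambda\mathcal{A}_\Lambda$ (so $\mathcal{A}\simeq M_{2^\infty}$). The star and face operators are $A_v=\prod_{e\ni v}\sigma^x_e$ and $B_{\tilde v}=\prod_{e\in\tilde v}\sigma^z_e$; they are pairwise commuting self-adjoint unitaries. A sub-$C^\ast$-algebra $\mathcal{B}\subset\mathcal{A}$ is a masa if it is abelian and its relative commutant in $\mathcal{A}$ is $\mathcal{B}$ itself. A masa is regular if its set of normalizers $N_{\mathcal{A}}(\mathcal{B})=\{n\in\mathcal{A}\mid n^\ast\mathcal{B}n\subset\mathcal{B}\text{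 and }n\mathcal{B}n^\ast\subset\mathcal{B}\}$ generates $\mathcal{A}$ as a $C^\ast$-algebra. *)

theory Defs
  imports "HOL-Analysis.Analysis"
begin

subsection \<open>C*-algebras\<close>

text \<open>A unital complex *-algebra with a C*-norm, not assumed complete; \<open>adj\<close> is the involution.\<close>

class pre_cstar_algebra = real_normed_algebra_1 +
  fixes scaleC :: "complex \<Rightarrow> 'a \<Rightarrow> 'a"  (infixr "*\<^sub>C" 75)
    and adj :: "'a \<Rightarrow> 'a"
  assumes scaleC_add_right: "c *\<^sub>C (x + y) = c *\<^sub>C x + c *\<^sub>C y"
    and scaleC_add_left: "(c + d) *\<^sub>C x = c *\<^sub>C x + d *\<^sub>C x"
    and scaleC_scaleC: "c *\<^sub>C d *\<^sub>C x = (c * d) *\<^sub>C x"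
    and scaleR_eq_scaleC: "r *\<^sub>R x = complex_of_real r *\<^sub>C x"
    and mult_scaleC_left: "(c *\<^sub>C x) * y = c *\<^sub>C (x * y)"
    and mult_scaleC_right: "x * (c *\<^sub>C y) = c *\<^sub>C (x * y)"
    and norm_scaleC: "norm (c *\<^sub>C x) = cmod c * norm x"
    and adj_adj: "adj (adj x) = x"
    and adj_add: "adj (x + y) = adj x + adj y"
    and adj_scaleC: "adj (c *\<^sub>C x) = cnj c *\<^sub>C adj x"
    and adj_mult: "adj (x * y) = adj y * adj x"
    and norm_adj_mult_self: "norm (adj x * x) = (norm x)\<^sup>2"

class cstar_algebra = pre_cstar_algebra + banach

lemma adj_minus: "adj (x - y) = adj x - adj (y::'a::pre_cstar_algebra)"
  using adj_add[of "x - y" y] by (simp add: algebra_simps)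

lemma norm_adj: "norm (adj x) = norm (x::'a::pre_cstar_algebra)"
proof -
  have *: "norm y \<le> norm (adj y)" for y :: 'a
  proof (cases "norm y = 0")
    case False
    have "norm y * norm y \<le> norm (adj y) * norm y"
      using norm_mult_ineq[of "adj y" y] norm_adj_mult_self[of y] by (simp add: power2_eq_square)
    with False show ?thesis by simp
  qed simp
  show ?thesis using *[of x] *[of "adj x"] by (simp add: adj_adj)
qed

lemma scaleC_minus: "c *\<^sub>C (x - y) = c *\<^sub>C x - c *\<^sub>C (y::'a::pre_cstar_algebra)"
  using scaleC_add_right[of c "x - y" y] by (simp add: algebra_simps)

subsection \<open>The C*-completion\<close>

text \<open>Cauchy sequences modulo null sequences, with all operations defined termwise and the norm
  of a class given by the limit of the norms.\<close>

definition compl_rel :: "(nat \<Rightarrow> 'a::pre_cstar_algebra) \<Rightarrow> (nat \<Rightarrow> 'a) \<Rightarrow> bool"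
  where "compl_rel X Y \<longleftrightarrow> Cauchy X \<and> Cauchy Y \<and> (\<lambda>n. X n - Y n) \<longlonglongrightarrow> 0"

lemma Cauchy_const [simp]: "Cauchy (\<lambda>_. x :: 'a::metric_space)"
  by (auto simp: Cauchy_def)

lemma Cauchy_add:
  fixes X Y :: "nat \<Rightarrow> 'a::real_normed_vector"
  assumes "Cauchy X" "Cauchy Y"
  shows "Cauchy (\<lambda>n. X n + Y n)"
proof (rule CauchyI)
  fix e :: real assume "e > 0"
  then have "e / 2 > 0" by simp
  then obtain M N where
    M: "\<And>m n. m \<ge> M \<Longrightarrow> n \<ge> M \<Longrightarrow> norm (X m - X n) < e / 2" and
    N: "\<And>m n. m \<ge> N \<Longrightarrow> n \<ge> N \<Longrightarrow> norm (Y m - Y n) < e / 2"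
    using assms by (meson Cauchy_iff)
  show "\<exists>M. \<forall>m\<ge>M. \<forall>n\<ge>M. norm (X m + Y m - (X n + Y n)) < e"
    using norm_diff_triangle_ineq M N
    by (intro exI[of _ "max M N"] allI impI)
       (smt (verit) max.bounded_iff field_sum_of_halves norm_diff_triangle_ineq)
qed

lemma Cauchy_Lipschitz_image:
  assumes "Cauchy X" "\<And>x y. norm (f x - f y) \<le> C * norm (x - y)"
  shows "Cauchy (\<lambda>n. f (X n) :: 'b::real_normed_vector)"
proof (rule CauchyI)
  fix e :: real assume e: "e > 0"
  have "e / (\<bar>C\<bar> + 1) > 0" using e by simp
  then obtain M where M: "\<And>m n. m \<ge> M \<Longrightarrow> n \<ge> M \<Longrightarrow> norm (X m - X n) < e / (\<bar>C\<bar> + 1)"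
    using assms(1) by (meson Cauchy_iff)
  show "\<exists>M. \<forall>m\<ge>M. \<forall>n\<ge>M. norm (f (X m) - f (X n)) < e"
  proof (intro exI allI impI)
    fix m n assume mn: "m \<ge> M" "n \<ge> M"
    have "norm (f (X m) - f (X n)) \<le> C * norm (X m - X n)" by (rule assms)
    also have "\<dots> \<le> (\<bar>C\<bar> + 1) * norm (X m - X n)" by (rule mult_right_mono) auto
    also have "\<dots> < e" using M[OF mn] by (simp add: field_simps)
    finally show "norm (f (X m) - f (X n)) < e" .
  qed
qed

lemma Cauchy_norm_seq: "Cauchy X \<Longrightarrow> Cauchy (\<lambda>n. norm (X n))"
  by (rule Cauchy_Lipschitz_image[of X norm 1]) (simp_all add: norm_triangle_ineq3)

lemma Cauchy_mult_seq:
  fixes X Y :: "nat \<Rightarrow> 'a::real_normed_algebra"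
  assumes "Cauchy X" "Cauchy Y"
  shows "Cauchy (\<lambda>n. X n * Y n)"
proof (rule CauchyI)
  fix e :: real assume e: "e > 0"
  obtain K where K: "K > 0" "\<And>n. norm (X n) \<le> K"
    using Cauchy_Bseq[OF assms(1)] by (auto simp: Bseq_def)
  obtain L where L: "L > 0" "\<And>n. norm (Y n) \<le> L"
    using Cauchy_Bseq[OF assms(2)] by (auto simp: Bseq_def)
  have "e / (2 * L) > 0" "e / (2 * K) > 0" using e K L by simp_all
  then obtain M N where
    M: "\<And>m n. m \<ge> M \<Longrightarrow> n \<ge> M \<Longrightarrow> norm (X m - X n) < e / (2 * L)" and
    N: "\<And>m n. m \<ge> N \<Longrightarrow> n \<ge> N \<Longrightarrow> norm (Y m - Y n) < e / (2 * K)"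
    using assms by (meson Cauchy_iff)
  show "\<exists>M. \<forall>m\<ge>M. \<forall>n\<ge>M. norm (X m * Y m - X n * Y n) < e"
  proof (intro exI allI impI)
    fix m n assume mn: "m \<ge> max M N" "n \<ge> max M N"
    have "X m * Y m - X n * Y n = (X m - X n) * Y m + X n * (Y m - Y n)"
      by (simp add: algebra_simps)
    also have "norm \<dots> \<le> norm (X m - X n) * norm (Y m) + norm (X n) * norm (Y m - Y n)"
      by (intro norm_triangle_le add_mono norm_mult_ineq)
    also have "\<dots> \<le> norm (X m - X n) * L + K * norm (Y m - Y n)"
      using K L by (intro add_mono mult_mono) (auto intro: less_imp_le)
    also have "\<dots> < e / (2 * L) * L + K * (e / (2 * K))"
      using M[of m n] N[of m n] mn K(1) L(1)
      by (intro add_strict_mono mult_strict_right_mono mult_strict_left_mono) auto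
    also have "\<dots> = e" using K(1) L(1) by (simp add: field_simps)
    finally show "norm (X m * Y m - X n * Y n) < e" .
  qed
qed

lemma part_equivp_compl_rel: "part_equivp (compl_rel :: (nat \<Rightarrow> 'a::pre_cstar_algebra) \<Rightarrow> _)"
proof (rule part_equivpI)
  show "\<exists>X::nat \<Rightarrow> 'a. compl_rel X X"
    by (rule exI[of _ "\<lambda>_. 0"]) (simp add: compl_rel_def)
  show "symp (compl_rel :: (nat \<Rightarrow> 'a) \<Rightarrow> _)"
  proof (rule sympI)
    fix X Y :: "nat \<Rightarrow> 'a" assume "compl_rel X Y"
    then show "compl_rel Y X"
      using tendsto_minus[of "\<lambda>n. X n - Y n" 0 sequentially] by (simp add: compl_rel_def)
  qed
  show "transp (compl_rel :: (nat \<Rightarrow> 'a) \<Rightarrow> _)"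
  proof (rule transpI)
    fix X Y Z :: "nat \<Rightarrow> 'a" assume "compl_rel X Y" "compl_rel Y Z"
    then show "compl_rel X Z"
      using tendsto_add[of "\<lambda>n. X n - Y n" 0 sequentially "\<lambda>n. Y n - Z n" 0]
      by (simp add: compl_rel_def)
  qed
qed

quotient_type (overloaded) 'a completion = "nat \<Rightarrow> 'a::pre_cstar_algebra" / partial: compl_rel
  morphisms rep_completion limit_of
  by (rule part_equivp_compl_rel)

lemma compl_rel_refl [simp]: "compl_rel X X \<longleftrightarrow> Cauchy X"
  by (simp add: compl_rel_def)

lemma compl_relD: "compl_rel X Y \<Longrightarrow> Cauchy X" "compl_rel X Y \<Longrightarrow> Cauchy Y"
    "compl_rel X Y \<Longrightarrow> (\<lambda>n. X n - Y n) \<longlonglongrightarrow> 0"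
  by (simp_all add: compl_rel_def)

lemma compl_rel_norm_lim:
  assumes "compl_rel X Y"
  shows "lim (\<lambda>n. norm (X n)) = lim (\<lambda>n. norm (Y n))"
proof -
  have "(\<lambda>n. norm (Y n)) \<longlonglongrightarrow> lim (\<lambda>n. norm (Y n))"
    using Cauchy_norm_seq[OF compl_relD(2)[OF assms]]
    by (simp add: real_Cauchy_convergent flip: convergent_LIMSEQ_iff)
  moreover have "(\<lambda>n. norm (X n) - norm (Y n)) \<longlonglongrightarrow> 0"
    by (rule tendsto_rabs_zero_cancel, rule Lim_null_comparison[OF _ tendsto_norm_zero[OF compl_relD(3)[OF assms]]])
       (simp add: norm_triangle_ineq3)
  ultimately have "(\<lambda>n. norm (Y n) + (norm (X n) - norm (Y n))) \<longlonglongrightarrow> lim (\<lambda>n. norm (Y n)) + 0"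
    by (rule tendsto_add)
  then show ?thesis by (simp add: limI)
qed

lemma compl_rel_mult:
  fixes X Y Z W :: "nat \<Rightarrow> 'a::pre_cstar_algebra"
  assumes "compl_rel X Y" "compl_rel Z W"
  shows "compl_rel (\<lambda>n. X n * Z n) (\<lambda>n. Y n * W n)"
proof -
  have B: "Bfun X sequentially" "Bfun W sequentially"
    using compl_relD(1)[OF assms(1)] compl_relD(2)[OF assms(2)] by (auto intro: Cauchy_Bseq)
  have "(\<lambda>n. X n * (Z n - W n)) \<longlonglongrightarrow> 0"
    using compl_relD(3)[OF assms(2)] B(1)
    by (simp add: tendsto_Zfun_iff bounded_bilinear.Bfun_prod_Zfun[OF bounded_bilinear_mult])
  moreover have "(\<lambda>n. (X n - Y n) * W n) \<longlonglongrightarrow> 0"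
    using compl_relD(3)[OF assms(1)] B(2)
    by (simp add: tendsto_Zfun_iff bounded_bilinear.Zfun_prod_Bfun[OF bounded_bilinear_mult])
  ultimately have "(\<lambda>n. X n * (Z n - W n) + (X n - Y n) * W n) \<longlonglongrightarrow> 0 + 0"
    by (rule tendsto_add)
  then show ?thesis
    using assms by (simp add: compl_rel_def Cauchy_mult_seq algebra_simps)
qed

lemma compl_rel_Lipschitz:
  assumes "compl_rel X Y" "\<And>x y. norm (f x - f y) \<le> C * norm (x - y)"
  shows "compl_rel (\<lambda>n. f (X n)) (\<lambda>n. f (Y n))"
proof -
  have "(\<lambda>n. C * norm (X n - Y n)) \<longlonglongrightarrow> C * 0"
    by (intro tendsto_mult tendsto_const tendsto_norm_zero compl_relD(3) assms)
  then have "(\<lambda>n. f (X n) - f (Y n)) \<longlonglongrightarrow> 0"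
    using assms(2) by (intro Lim_null_comparison[of "\<lambda>n. f (X n) - f (Y n)" "\<lambda>n. C * norm (X n - Y n)"]) auto
  then show ?thesis
    using assms(1) Cauchy_Lipschitz_image[OF _ assms(2)] by (simp add: compl_rel_def)
qed

instantiation completion :: (pre_cstar_algebra) pre_cstar_algebra
begin

lift_definition zero_completion :: "'a completion" is "\<lambda>_. 0" by simp
lift_definition one_completion :: "'a completion" is "\<lambda>_. 1" by simp

lift_definition plus_completion :: "'a completion \<Rightarrow> 'a completion \<Rightarrow> 'a completion"
  is "\<lambda>X Y n. X n + Y n"
  subgoal for X X' Y Y'
    using tendsto_add[of "\<lambda>n. X n - X' n" 0 sequentially "\<lambda>n. Y n - Y' n" 0]
    by (simp add: compl_rel_def Cauchy_add add_diff_add)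
  done

lift_definition uminus_completion :: "'a completion \<Rightarrow> 'a completion" is "\<lambda>X n. - X n"
  by (erule compl_rel_Lipschitz[where C=1]) (simp add: norm_minus_commute)

definition minus_completion :: "'a completion \<Rightarrow> 'a completion \<Rightarrow> 'a completion"
  where "minus_completion x y = x + - y"

lift_definition times_completion :: "'a completion \<Rightarrow> 'a completion \<Rightarrow> 'a completion"
  is "\<lambda>X Y n. X n * Y n" by (rule compl_rel_mult)

lift_definition scaleC_completion :: "complex \<Rightarrow> 'a completion \<Rightarrow> 'a completion"
  is "\<lambda>c X n. c *\<^sub>C X n"
  subgoal for c X Y
    by (erule compl_rel_Lipschitz[where C="cmod c"]) (simp flip: scaleC_minus add: norm_scaleC)
  done

definition scaleR_completion :: "real \<Rightarrow> 'a completion \<Rightarrow> 'a completion"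
  where "scaleR_completion r x = complex_of_real r *\<^sub>C x"

lift_definition adj_completion :: "'a completion \<Rightarrow> 'a completion" is "\<lambda>X n. adj (X n)"
  by (erule compl_rel_Lipschitz[where C=1]) (simp flip: adj_minus add: norm_adj)

lift_definition norm_completion :: "'a completion \<Rightarrow> real" is "\<lambda>X. lim (\<lambda>n. norm (X n))"
  by (rule compl_rel_norm_lim)

definition sgn_completion :: "'a completion \<Rightarrow> 'a completion"
  where "sgn_completion x = inverse (norm x) *\<^sub>R x"

definition dist_completion :: "'a completion \<Rightarrow> 'a completion \<Rightarrow> real"
  where "dist_completion x y = norm (x - y)"

definition
  "(uniformity :: ('a completion \<times> 'a completion) filter) = (INF e\<in>{0 <..}. principal {(x, y). dist x y < e})"

definition open_completion :: "'a completion set \<Rightarrow> bool"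
  where "open_completion S = (\<forall>x\<in>S. \<forall>\<^sub>F (x', y) in uniformity. x' = x \<longrightarrow> y \<in> S)"

lemma norm_completion_LIMSEQ:
  "Cauchy X \<Longrightarrow> (\<lambda>n. norm (X n)) \<longlonglongrightarrow> lim (\<lambda>n. norm (X n :: 'a))"
  using Cauchy_norm_seq[of X] by (simp add: real_Cauchy_convergent flip: convergent_LIMSEQ_iff)

instance
proof
  fix x y z :: "'a completion" and c d :: complex and r q :: real
  show "x + y + z = x + (y + z)" by transfer (simp add: add.assoc Cauchy_add)
  show "x + y = y + x" by transfer (simp add: add.commute Cauchy_add)
  show "0 + x = x" by transfer simp
  show "- x + x = 0" by transfer simp
  show "x - y = x + - y" by (rule minus_completion_def)
  show "x * y * z = x * (y * z)" by transfer (simp add: mult.assoc Cauchy_mult_seq)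
  show "1 * x = x" "x * 1 = x" by (transfer, simp)+
  show "(x + y) * z = x * z + y * z"
    by transfer (simp add: distrib_right Cauchy_mult_seq Cauchy_add)
  show "x * (y + z) = x * y + x * z"
    by transfer (simp add: distrib_left Cauchy_mult_seq Cauchy_add)
  have norm1: "norm (1::'a completion) = 1" by transfer simp
  have norm0: "norm (0::'a completion) = 0" by transfer simp
  show "(0::'a completion) \<noteq> 1" using norm1 norm0 by auto
  show "norm (1::'a completion) = 1" by (rule norm1)
  have CS: "Cauchy (\<lambda>n. c *\<^sub>C X n)" if "Cauchy X" for c and X :: "nat \<Rightarrow> 'a"
    using that by (rule Cauchy_Lipschitz_image[where C="cmod c"]) (simp flip: scaleC_minus add: norm_scaleC)
  have CA: "Cauchy (\<lambda>n. adj (X n))" if "Cauchy X" for X :: "nat \<Rightarrow> 'a"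
    using that by (rule Cauchy_Lipschitz_image[where C=1]) (simp flip: adj_minus add: norm_adj)
  note C = CS CA Cauchy_add Cauchy_mult_seq
  have addr: "c *\<^sub>C (x + y) = c *\<^sub>C x + c *\<^sub>C y" for c and x y :: "'a completion"
    by transfer (simp add: scaleC_add_right C)
  have addl: "(c + d) *\<^sub>C x = c *\<^sub>C x + d *\<^sub>C x" for c d and x :: "'a completion"
    by transfer (simp add: scaleC_add_left C)
  have sc: "c *\<^sub>C d *\<^sub>C x = (c * d) *\<^sub>C x" for c d and x :: "'a completion"
    by transfer (simp add: scaleC_scaleC C)
  have one: "1 *\<^sub>C X = (X::'a)" for X
    using scaleR_eq_scaleC[of 1 X] by simp
  have onec: "1 *\<^sub>C x = x" for x :: "'a completion"
    by transfer (simp add: one)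
  have ml: "(c *\<^sub>C x) * y = c *\<^sub>C (x * y)" for c and x y :: "'a completion"
    by transfer (simp add: mult_scaleC_left C)
  have mr: "x * (c *\<^sub>C y) = c *\<^sub>C (x * y)" for c and x y :: "'a completion"
    by transfer (simp add: mult_scaleC_right C)
  have ns: "norm (c *\<^sub>C x) = cmod c * norm x" for c and x :: "'a completion"
  proof transfer
    fix c and X :: "nat \<Rightarrow> 'a" assume "compl_rel X X"
    then have "(\<lambda>n. norm (c *\<^sub>C X n)) \<longlonglongrightarrow> cmod c * lim (\<lambda>n. norm (X n))"
      by (simp add: norm_scaleC tendsto_mult norm_completion_LIMSEQ)
    then show "lim (\<lambda>n. norm (c *\<^sub>C X n)) = cmod c * lim (\<lambda>n. norm (X n))" by (rule limI)
  qed
  show "c *\<^sub>C (x + y) = c *\<^sub>C x + c *\<^sub>C y" by (rule addr)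
  show "(c + d) *\<^sub>C x = c *\<^sub>C x + d *\<^sub>C x" by (rule addl)
  show "c *\<^sub>C d *\<^sub>C x = (c * d) *\<^sub>C x" by (rule sc)
  show "r *\<^sub>R x = complex_of_real r *\<^sub>C x" by (rule scaleR_completion_def)
  show "(c *\<^sub>C x) * y = c *\<^sub>C (x * y)" by (rule ml)
  show "x * (c *\<^sub>C y) = c *\<^sub>C (x * y)" by (rule mr)
  show "norm (c *\<^sub>C x) = cmod c * norm x" by (rule ns)
  show "r *\<^sub>R (x + y) = r *\<^sub>R x + r *\<^sub>R y" "(r + q) *\<^sub>R x = r *\<^sub>R x + q *\<^sub>R x"
    "r *\<^sub>R q *\<^sub>R x = (r * q) *\<^sub>R x" "1 *\<^sub>R x = x"
    "r *\<^sub>R x * y = r *\<^sub>R (x * y)" "x * r *\<^sub>R y = r *\<^sub>R (x * y)" "norm (r *\<^sub>R x) = \<bar>r\<bar> * norm x"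
    by (simp_all add: scaleR_completion_def addr addl sc onec ml mr ns)
  show "adj (adj x) = x" by transfer (simp add: adj_adj)
  show "adj (x + y) = adj x + adj y" by transfer (simp add: adj_add C)
  show "adj (c *\<^sub>C x) = cnj c *\<^sub>C adj x" by transfer (simp add: adj_scaleC C)
  show "adj (x * y) = adj y * adj x" by transfer (simp add: adj_mult C)
  show "norm (adj x * x) = (norm x)\<^sup>2"
  proof transfer
    fix X :: "nat \<Rightarrow> 'a" assume "compl_rel X X"
    then have "(\<lambda>n. norm (adj (X n) * X n)) \<longlonglongrightarrow> (lim (\<lambda>n. norm (X n)))\<^sup>2"
      by (simp add: norm_adj_mult_self tendsto_power norm_completion_LIMSEQ)
    then show "lim (\<lambda>n. norm (adj (X n) * X n)) = (lim (\<lambda>n. norm (X n)))\<^sup>2" by (rule limI)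
  qed
  show "norm (x + y) \<le> norm x + norm y"
  proof transfer
    fix X Y :: "nat \<Rightarrow> 'a" assume *: "compl_rel X X" "compl_rel Y Y"
    then have "(\<lambda>n. norm (X n) + norm (Y n)) \<longlonglongrightarrow> lim (\<lambda>n. norm (X n)) + lim (\<lambda>n. norm (Y n))"
      by (simp add: tendsto_add norm_completion_LIMSEQ)
    moreover have "(\<lambda>n. norm (X n + Y n)) \<longlonglongrightarrow> lim (\<lambda>n. norm (X n + Y n))"
      using * by (intro norm_completion_LIMSEQ) (simp add: C)
    ultimately show "lim (\<lambda>n. norm (X n + Y n)) \<le> lim (\<lambda>n. norm (X n)) + lim (\<lambda>n. norm (Y n))"
      by (intro LIMSEQ_le) (auto intro: norm_triangle_ineq)
  qed
  show "norm (x * y) \<le> norm x * norm y"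
  proof transfer
    fix X Y :: "nat \<Rightarrow> 'a" assume *: "compl_rel X X" "compl_rel Y Y"
    then have "(\<lambda>n. norm (X n) * norm (Y n)) \<longlonglongrightarrow> lim (\<lambda>n. norm (X n)) * lim (\<lambda>n. norm (Y n))"
      by (simp add: tendsto_mult norm_completion_LIMSEQ)
    moreover have "(\<lambda>n. norm (X n * Y n)) \<longlonglongrightarrow> lim (\<lambda>n. norm (X n * Y n))"
      using * by (intro norm_completion_LIMSEQ) (simp add: C)
    ultimately show "lim (\<lambda>n. norm (X n * Y n)) \<le> lim (\<lambda>n. norm (X n)) * lim (\<lambda>n. norm (Y n))"
      by (intro LIMSEQ_le) (auto intro: norm_mult_ineq)
  qed
  show "norm x = 0 \<longleftrightarrow> x = 0"
  proof transfer
    fix X :: "nat \<Rightarrow> 'a" assume *: "compl_rel X X"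
    then have "lim (\<lambda>n. norm (X n)) = 0 \<longleftrightarrow> (\<lambda>n. norm (X n)) \<longlonglongrightarrow> 0"
      using norm_completion_LIMSEQ[of X] by (auto intro: limI)
    then show "lim (\<lambda>n. norm (X n)) = 0 \<longleftrightarrow> compl_rel X (\<lambda>_. 0)"
      using * by (simp add: compl_rel_def tendsto_norm_zero_iff)
  qed
  show "dist x y = norm (x - y)" by (rule dist_completion_def)
  show "sgn x = inverse (norm x) *\<^sub>R x" by (rule sgn_completion_def)
qed (rule uniformity_completion_def open_completion_def)+

end

text \<open>The canonical isometric embedding (classes of constant sequences); its range is dense.\<close>

lift_definition of_pre :: "'a::pre_cstar_algebra \<Rightarrow> 'a completion" is "\<lambda>a _. a" by simp

lemma norm_of_pre [simp]: "norm (of_pre a) = norm a"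
  by transfer simp

lemma of_pre_minus: "of_pre (a - b) = of_pre a - of_pre b"
  unfolding minus_completion_def by transfer simp

lemma norm_limit_of: "Cauchy X \<Longrightarrow> norm (limit_of X) = lim (\<lambda>n. norm (X n))"
  by (simp add: norm_completion.abs_eq)

lemma of_pre_limit_of: "Cauchy X \<Longrightarrow> of_pre a - limit_of X = limit_of (\<lambda>n. a - X n)"
  unfolding minus_completion_def of_pre.abs_eq
  by (subst uminus_completion.abs_eq, simp, subst plus_completion.abs_eq)
     (auto simp: Cauchy_Lipschitz_image[where C=1 and f=uminus] norm_minus_commute)

lemma of_pre_tendsto:
  fixes X :: "nat \<Rightarrow> 'a::pre_cstar_algebra"
  assumes X: "Cauchy X"
  shows "(\<lambda>n. of_pre (X n)) \<longlonglongrightarrow> limit_of X"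
proof (rule LIMSEQ_I)
  fix e :: real assume "e > 0"
  then have "e / 2 > 0" by simp
  then obtain M where M: "\<And>m n. m \<ge> M \<Longrightarrow> n \<ge> M \<Longrightarrow> norm (X m - X n) < e / 2"
    using X by (meson Cauchy_iff)
  show "\<exists>no. \<forall>n\<ge>no. norm (of_pre (X n) - limit_of X) < e"
  proof (intro exI allI impI)
    fix m assume m: "m \<ge> M"
    have C: "Cauchy (\<lambda>n. X m - X n)"
      by (rule Cauchy_Lipschitz_image[OF X, where C=1]) (simp add: norm_minus_commute)
    have "lim (\<lambda>n. norm (X m - X n)) \<le> e / 2"
      by (rule LIMSEQ_le_const2[OF norm_completion_LIMSEQ[OF C]]) (use M m in \<open>force intro: less_imp_le\<close>)
    with \<open>e > 0\<close> show "norm (of_pre (X m) - limit_of X) < e"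
      by (simp add: of_pre_limit_of X norm_limit_of C)
  qed
qed

lemma of_pre_dense:
  assumes "e > 0"
  shows "\<exists>a. norm (x - of_pre a) < e"
proof -
  obtain X where X: "x = limit_of X" "Cauchy X"
    by (induction x rule: completion.abs_induct) auto
  from LIMSEQ_D[OF of_pre_tendsto[OF X(2)] assms] show ?thesis
    by (auto simp: X norm_minus_commute)
qed

instance completion :: (pre_cstar_algebra) cstar_algebra
proof
  fix x :: "nat \<Rightarrow> 'a completion" assume x: "Cauchy x"
  have "\<exists>a. norm (x n - of_pre a) < 1 / Suc n" for n by (rule of_pre_dense) simp
  then obtain a where a: "\<And>n. norm (x n - of_pre (a n)) < 1 / Suc n" by metis
  have null: "(\<lambda>n. of_pre (a n) - x n) \<longlonglongrightarrow> 0"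
    by (rule Lim_null_comparison[OF _ LIMSEQ_inverse_real_of_nat])
       (use a in \<open>auto simp: norm_minus_commute inverse_eq_divide intro!: always_eventually less_imp_le\<close>)
  have "Cauchy (\<lambda>n. x n + (of_pre (a n) - x n))"
    by (intro Cauchy_add x LIMSEQ_imp_Cauchy[OF null])
  then have "Cauchy (\<lambda>n. of_pre (a n))" by simp
  then have "Cauchy a" by (simp add: Cauchy_iff flip: of_pre_minus)
  then have "(\<lambda>n. of_pre (a n)) \<longlonglongrightarrow> limit_of a" by (rule of_pre_tendsto)
  from tendsto_diff[OF this null] show "convergent x" by (auto simp: convergent_def)
qed

subsection \<open>The local algebras\<close>

text \<open>Every site \<open>e\<close> carries the matrix algebra of 2-by-2 complex matrices. For finite \<open>\<Lambda>\<close> the tensor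
  product of the algebras at the sites of \<open>\<Lambda>\<close> is the full matrix algebra over the index set of
  configurations on \<open>\<Lambda>\<close> (functions from \<open>\<Lambda>\<close> to the index type \<open>2\<close>). To turn the natural inclusions
  into inclusions of sets, such a matrix \<open>M\<close> is stored as \<open>M\<close> tensored with the identity off \<open>\<Lambda>\<close>,
  i.e. as a matrix indexed by configurations of all sites; \<open>eq_off \<Lambda> s t\<close> is the entry of that
  identity.\<close>

definition eq_off :: "'e set \<Rightarrow> ('e \<Rightarrow> 2) \<Rightarrow> ('e \<Rightarrow> 2) \<Rightarrow> bool"
  where "eq_off \<Lambda> s t \<longleftrightarrow> (\<forall>e. e \<notin> \<Lambda> \<longrightarrow> s e = t e)"

definition local_mats :: "'e set \<Rightarrow> (('e \<Rightarrow> 2) \<Rightarrow> ('e \<Rightarrow> 2) \<Rightarrow> complex) set"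
  where "local_mats \<Lambda> = {a. \<exists>M. \<forall>s t.
     a s t = (if eq_off \<Lambda> s t then M (restrict s \<Lambda>) (restrict t \<Lambda>) else 0)}"

text \<open>All rows of a matrix in \<open>local_mats \<Lambda>\<close> are finite when \<open>\<Lambda>\<close> is, so the following are finite sums.\<close>

definition mat_mult :: "('i \<Rightarrow> 'i \<Rightarrow> complex) \<Rightarrow> ('i \<Rightarrow> 'i \<Rightarrow> complex) \<Rightarrow> 'i \<Rightarrow> 'i \<Rightarrow> complex"
  where "mat_mult a b s u = (\<Sum>t | a s t \<noteq> 0. a s t * b t u)"

definition mat_apply :: "('i \<Rightarrow> 'i \<Rightarrow> complex) \<Rightarrow> ('i \<Rightarrow> complex) \<Rightarrow> 'i \<Rightarrow> complex"
  where "mat_apply a \<psi> s = (\<Sum>t | a s t \<noteq> 0. a s t * \<psi> t)"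

definition fin_vec :: "('i \<Rightarrow> complex) \<Rightarrow> bool"
  where "fin_vec \<psi> \<longleftrightarrow> finite {s. \<psi> s \<noteq> 0}"

definition vec_norm :: "('i \<Rightarrow> complex) \<Rightarrow> real"
  where "vec_norm \<psi> = sqrt (\<Sum>s | \<psi> s \<noteq> 0. (cmod (\<psi> s))\<^sup>2)"

text \<open>The operator norm for the action on finitely supported vectors. Under the
  decomposition of configurations into classes agreeing off \<open>\<Lambda>\<close>, a matrix in \<open>local_mats \<Lambda>\<close> acts by a
  copy of \<open>M\<close> on each class, so this is the usual C*-norm of \<open>M\<close>.\<close>

definition op_norm :: "('i \<Rightarrow> 'i \<Rightarrow> complex) \<Rightarrow> real"
  where "op_norm a = (SUP \<psi>\<in>{\<psi>. fin_vec \<psi> \<and> vec_norm \<psi> \<le> 1}. vec_norm (mat_apply a \<psi>))"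

lemma eq_off_refl [simp]: "eq_off \<Lambda> s s" by (simp add: eq_off_def)
lemma eq_off_sym: "eq_off \<Lambda> s t \<longleftrightarrow> eq_off \<Lambda> t s" by (auto simp: eq_off_def)
lemma eq_off_trans: "eq_off \<Lambda> s t \<Longrightarrow> eq_off \<Lambda> t u \<Longrightarrow> eq_off \<Lambda> s u" by (simp add: eq_off_def)

lemma bij_betw_restrict:
  "bij_betw (\<lambda>t. restrict t \<Lambda>) {t. eq_off \<Lambda> s t} (PiE \<Lambda> (\<lambda>_. UNIV))"
  by (rule bij_betw_byWitness[where f' = "\<lambda>w. override_on s w \<Lambda>"])
     (auto simp: eq_off_def override_on_def fun_eq_iff PiE_def extensional_def)

lemma finite_eq_off: "finite \<Lambda> \<Longrightarrow> finite {t. eq_off \<Lambda> s t}"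
  using bij_betw_finite[OF bij_betw_restrict[of \<Lambda> s]] by (simp add: finite_PiE)

lemma card_eq_off: "card {t. eq_off \<Lambda> s t} = card (PiE \<Lambda> (\<lambda>_. UNIV :: 2 set))"
  by (rule bij_betw_same_card[OF bij_betw_restrict])

lemma local_matsE:
  assumes "a \<in> local_mats \<Lambda>"
  obtains M where "\<And>s t. a s t = (if eq_off \<Lambda> s t then M (restrict s \<Lambda>) (restrict t \<Lambda>) else 0)"
  using assms by (auto simp: local_mats_def)

lemma local_matsI:
  assumes "\<And>s t. a s t = (if eq_off \<Lambda> s t then M (restrict s \<Lambda>) (restrict t \<Lambda>) else 0)"
  shows "a \<in> local_mats \<Lambda>"
  using assms by (auto simp: local_mats_def)

lemma local_mats_eq_off: "a \<in> local_mats \<Lambda> \<Longrightarrow> a s t \<noteq> 0 \<Longrightarrow> eq_off \<Lambda> s t"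
  by (auto elim!: local_matsE split: if_splits)

lemma local_mats_mono:
  assumes "\<Lambda> \<subseteq> \<Lambda>'"
  shows "local_mats \<Lambda> \<subseteq> (local_mats \<Lambda>' :: (('e \<Rightarrow> 2) \<Rightarrow> ('e \<Rightarrow> 2) \<Rightarrow> complex) set)"
proof
  fix a :: "('e \<Rightarrow> 2) \<Rightarrow> ('e \<Rightarrow> 2) \<Rightarrow> complex" assume "a \<in> local_mats \<Lambda>"
  then obtain M where M: "\<And>s t. a s t = (if eq_off \<Lambda> s t then M (restrict s \<Lambda>) (restrict t \<Lambda>) else 0)"
    by (rule local_matsE) blast
  define N where "N = (\<lambda>p q. if \<forall>e\<in>\<Lambda>' - \<Lambda>. p e = q e then M (restrict p \<Lambda>) (restrict q \<Lambda>) else 0)"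
  have R: "restrict (restrict s \<Lambda>') \<Lambda> = restrict s \<Lambda>" for s :: "'e \<Rightarrow> 2"
    using assms by (auto simp: restrict_def fun_eq_iff)
  have "eq_off \<Lambda> s t \<longleftrightarrow> eq_off \<Lambda>' s t \<and> (\<forall>e\<in>\<Lambda>' - \<Lambda>. s e = t e)" for s t :: "'e \<Rightarrow> 2"
    using assms by (auto simp: eq_off_def)
  then show "a \<in> local_mats \<Lambda>'"
    by (intro local_matsI[where M=N]) (auto simp: M N_def R Int_absorb1[OF assms])
qed

lemma local_mats_finite_row: "finite \<Lambda> \<Longrightarrow> a \<in> local_mats \<Lambda> \<Longrightarrow> finite {t. a s t \<noteq> 0}"
  by (rule finite_subset[OF _ finite_eq_off[of \<Lambda> s]]) (auto dest: local_mats_eq_off)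

lemma mat_mult_eq:
  assumes "finite F" "{t. a s t \<noteq> 0} \<subseteq> F"
  shows "mat_mult a b s u = (\<Sum>t\<in>F. a s t * b t u)"
  unfolding mat_mult_def using assms by (intro sum.mono_neutral_left) auto

lemma mat_apply_eq:
  assumes "finite F" "{t. a s t \<noteq> 0} \<subseteq> F"
  shows "mat_apply a \<psi> s = (\<Sum>t\<in>F. a s t * \<psi> t)"
  unfolding mat_apply_def using assms by (intro sum.mono_neutral_left) auto

lemma mat_mult_local:
  assumes "finite \<Lambda>" "a \<in> local_mats \<Lambda>"
  shows "mat_mult a b s u = (\<Sum>t | eq_off \<Lambda> s t. a s t * b t u)"
  using assms by (intro mat_mult_eq finite_eq_off) (auto dest: local_mats_eq_off)

lemma mat_apply_local:
  assumes "finite \<Lambda>" "a \<in> local_mats \<Lambda>"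
  shows "mat_apply a \<psi> s = (\<Sum>t | eq_off \<Lambda> s t. a s t * \<psi> t)"
  using assms by (intro mat_apply_eq finite_eq_off) (auto dest: local_mats_eq_off)

lemma local_mats_mult:
  assumes fin: "finite \<Lambda>" and a: "a \<in> local_mats \<Lambda>" and b: "b \<in> local_mats \<Lambda>"
  shows "mat_mult a b \<in> local_mats \<Lambda>"
proof -
  obtain M where M: "\<And>s t. a s t = (if eq_off \<Lambda> s t then M (restrict s \<Lambda>) (restrict t \<Lambda>) else 0)"
    using a by (rule local_matsE) blast
  obtain N where N: "\<And>s t. b s t = (if eq_off \<Lambda> s t then N (restrict s \<Lambda>) (restrict t \<Lambda>) else 0)"
    using b by (rule local_matsE) blast
  show ?thesis
  proof (rule local_matsI[where M="\<lambda>p q. \<Sum>w\<in>PiE \<Lambda> (\<lambda>_. UNIV). M p w * N w q"])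
    fix s u
    show "mat_mult a b s u = (if eq_off \<Lambda> s u
      then \<Sum>w\<in>PiE \<Lambda> (\<lambda>_. UNIV). M (restrict s \<Lambda>) w * N w (restrict u \<Lambda>) else 0)"
    proof (cases "eq_off \<Lambda> s u")
      case True
      have "mat_mult a b s u = (\<Sum>t | eq_off \<Lambda> s t. M (restrict s \<Lambda>) (restrict t \<Lambda>) * N (restrict t \<Lambda>) (restrict u \<Lambda>))"
        unfolding mat_mult_local[OF fin a]
        by (rule sum.cong) (use True in \<open>auto simp: M N dest: eq_off_trans eq_off_sym[THEN iffD1]\<close>)
      also have "\<dots> = (\<Sum>w\<in>PiE \<Lambda> (\<lambda>_. UNIV). M (restrict s \<Lambda>) w * N w (restrict u \<Lambda>))"
        by (rule sum.reindex_bij_betw[OF bij_betw_restrict])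
      finally show ?thesis using True by simp
    next
      case False
      then show ?thesis
        unfolding mat_mult_local[OF fin a]
        by (auto intro!: sum.neutral simp: N dest: eq_off_trans)
    qed
  qed
qed

lemma local_mats_add:
  assumes "a \<in> local_mats \<Lambda>" "b \<in> local_mats \<Lambda>"
  shows "(\<lambda>s t. a s t + b s t) \<in> local_mats \<Lambda>"
proof -
  obtain M where M: "\<And>s t. a s t = (if eq_off \<Lambda> s t then M (restrict s \<Lambda>) (restrict t \<Lambda>) else 0)"
    using assms(1) by (rule local_matsE) blast
  obtain N where N: "\<And>s t. b s t = (if eq_off \<Lambda> s t then N (restrict s \<Lambda>) (restrict t \<Lambda>) else 0)"
    using assms(2) by (rule local_matsE) blast
  show ?thesis by (rule local_matsI[where M="\<lambda>p q. M p q + N p q"]) (simp add: M N)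
qed

lemma local_mats_scale:
  assumes "a \<in> local_mats \<Lambda>"
  shows "(\<lambda>s t. c * a s t) \<in> local_mats \<Lambda>"
proof -
  obtain M where M: "\<And>s t. a s t = (if eq_off \<Lambda> s t then M (restrict s \<Lambda>) (restrict t \<Lambda>) else 0)"
    using assms(1) by (rule local_matsE) blast
  show ?thesis by (rule local_matsI[where M="\<lambda>p q. c * M p q"]) (simp add: M)
qed

lemma local_mats_adj:
  assumes "a \<in> local_mats \<Lambda>"
  shows "(\<lambda>s t. cnj (a t s)) \<in> local_mats \<Lambda>"
proof -
  obtain M where M: "\<And>s t. a s t = (if eq_off \<Lambda> s t then M (restrict s \<Lambda>) (restrict t \<Lambda>) else 0)"
    using assms(1) by (rule local_matsE) blast
  show ?thesis
    by (rule local_matsI[where M="\<lambda>p q. cnj (M q p)"]) (auto simp: M eq_off_sym)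
qed

lemma local_mats_zero: "(\<lambda>_ _. 0) \<in> local_mats \<Lambda>"
  by (rule local_matsI[where M="\<lambda>_ _. 0"]) simp

lemma local_mats_one: "(\<lambda>s t. if s = t then 1 else 0) \<in> local_mats {}"
  by (rule local_matsI[where M="\<lambda>_ _. 1"]) (auto simp: eq_off_def)

lemma local_mats_bounded:
  assumes "finite \<Lambda>" "a \<in> local_mats \<Lambda>"
  obtains B where "\<And>s t. cmod (a s t) \<le> B" "B \<ge> 0"
proof -
  obtain M where M: "\<And>s t. a s t = (if eq_off \<Lambda> s t then M (restrict s \<Lambda>) (restrict t \<Lambda>) else 0)"
    using assms(2) by (rule local_matsE) blast
  define P where "P = PiE \<Lambda> (\<lambda>_. UNIV :: 2 set)"
  have P: "finite P" using assms(1) by (simp add: P_def finite_PiE)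
  define B where "B = (\<Sum>p\<in>P. \<Sum>q\<in>P. cmod (M p q))"
  have B0: "B \<ge> 0" unfolding B_def by (intro sum_nonneg) simp
  have "cmod (a s t) \<le> B" for s t
  proof -
    have "cmod (M (restrict s \<Lambda>) (restrict t \<Lambda>)) \<le> (\<Sum>q\<in>P. cmod (M (restrict s \<Lambda>) q))"
      by (rule member_le_sum) (auto simp: P, auto simp: P_def)
    also have "\<dots> \<le> B" unfolding B_def
      by (rule member_le_sum) (auto simp: P sum_nonneg, auto simp: P_def)
    finally show ?thesis using B0 by (simp add: M)
  qed
  with B0 show ?thesis using that by blast
qed

lemma vec_norm_eq:
  assumes "finite S" "{s. \<psi> s \<noteq> 0} \<subseteq> S"
  shows "vec_norm \<psi> = L2_set (\<lambda>s. cmod (\<psi> s)) S"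
  unfolding vec_norm_def L2_set_def using assms
  by (intro arg_cong[where f=sqrt] sum.mono_neutral_left) auto

lemma vec_norm_nonneg [simp]: "vec_norm \<psi> \<ge> 0"
  by (simp add: vec_norm_def sum_nonneg)

lemma fin_vec_zero [simp]: "fin_vec (\<lambda>_. 0)" by (simp add: fin_vec_def)
lemma vec_norm_zero [simp]: "vec_norm (\<lambda>_. 0) = 0" by (simp add: vec_norm_def)

lemma mat_apply_zero [simp]: "mat_apply a (\<lambda>_. 0) = (\<lambda>_. 0)"
  by (simp add: mat_apply_def fun_eq_iff)

lemma vec_norm_eq_0: "fin_vec \<psi> \<Longrightarrow> vec_norm \<psi> = 0 \<longleftrightarrow> \<psi> = (\<lambda>_. 0)"
  by (auto simp: vec_norm_eq[where S="{s. \<psi> s \<noteq> 0}"] fin_vec_def L2_set_eq_0_iff fun_eq_iff)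

lemma fin_vec_add: "fin_vec \<phi> \<Longrightarrow> fin_vec \<psi> \<Longrightarrow> fin_vec (\<lambda>s. \<phi> s + \<psi> s)"
  unfolding fin_vec_def by (rule finite_subset[of _ "{s. \<phi> s \<noteq> 0} \<union> {s. \<psi> s \<noteq> 0}"]) auto

lemma fin_vec_scale: "fin_vec \<psi> \<Longrightarrow> fin_vec (\<lambda>s. c * \<psi> s)"
  unfolding fin_vec_def by (rule finite_subset[of _ "{s. \<psi> s \<noteq> 0}"]) auto

lemma vec_norm_triangle:
  assumes "fin_vec \<phi>" "fin_vec \<psi>"
  shows "vec_norm (\<lambda>s. \<phi> s + \<psi> s) \<le> vec_norm \<phi> + vec_norm \<psi>"
proof -
  define S where "S = {s. \<phi> s \<noteq> 0} \<union> {s. \<psi> s \<noteq> 0}"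
  have S: "finite S" "{s. \<phi> s \<noteq> 0} \<subseteq> S" "{s. \<psi> s \<noteq> 0} \<subseteq> S" "{s. \<phi> s + \<psi> s \<noteq> 0} \<subseteq> S"
    using assms by (auto simp: S_def fin_vec_def)
  have "L2_set (\<lambda>s. cmod (\<phi> s + \<psi> s)) S \<le> L2_set (\<lambda>s. cmod (\<phi> s) + cmod (\<psi> s)) S"
    by (rule L2_set_mono) (auto intro: norm_triangle_ineq)
  also have "\<dots> \<le> L2_set (\<lambda>s. cmod (\<phi> s)) S + L2_set (\<lambda>s. cmod (\<psi> s)) S"
    by (rule L2_set_triangle_ineq)
  finally show ?thesis using S by (simp add: vec_norm_eq[of S])
qed

lemma vec_norm_scale:
  assumes "fin_vec \<psi>"
  shows "vec_norm (\<lambda>s. c * \<psi> s) = cmod c * vec_norm \<psi>"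
proof -
  define S where "S = {s. \<psi> s \<noteq> 0}"
  have S: "finite S" "{s. \<psi> s \<noteq> 0} \<subseteq> S" "{s. c * \<psi> s \<noteq> 0} \<subseteq> S"
    using assms by (auto simp: S_def fin_vec_def)
  then show ?thesis
    by (simp add: vec_norm_eq[of S] norm_mult L2_set_right_distrib)
qed

lemma fin_vec_apply:
  assumes "finite \<Lambda>" "a \<in> local_mats \<Lambda>" "fin_vec \<psi>"
  shows "fin_vec (mat_apply a \<psi>)"
proof -
  have "{s. mat_apply a \<psi> s \<noteq> 0} \<subseteq> (\<Union>t\<in>{t. \<psi> t \<noteq> 0}. {s. eq_off \<Lambda> t s})"
  proof
    fix s assume "s \<in> {s. mat_apply a \<psi> s \<noteq> 0}"
    then have "(\<Sum>t | eq_off \<Lambda> s t. a s t * \<psi> t) \<noteq> 0"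
      by (simp add: mat_apply_local[OF assms(1,2)])
    then obtain t where "eq_off \<Lambda> s t" "\<psi> t \<noteq> 0"
      by (metis (mono_tags, lifting) mem_Collect_eq mult_eq_0_iff sum.neutral)
    then show "s \<in> (\<Union>t\<in>{t. \<psi> t \<noteq> 0}. {s. eq_off \<Lambda> t s})" by (auto simp: eq_off_sym)
  qed
  then show ?thesis
    using assms by (auto simp: fin_vec_def intro!: finite_eq_off elim!: finite_subset)
qed

lemma mat_apply_bounded:
  assumes "finite \<Lambda>" "a \<in> local_mats \<Lambda>"
  obtains K where "K \<ge> 0" "\<And>\<psi>. fin_vec \<psi> \<Longrightarrow> vec_norm (mat_apply a \<psi>) \<le> K * vec_norm \<psi>"
proof -
  obtain B where B: "\<And>s t. cmod (a s t) \<le> B" "B \<ge> 0"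
    using local_mats_bounded[OF assms] by blast
  define N where "N = card (PiE \<Lambda> (\<lambda>_. UNIV :: 2 set))"
  have le: "vec_norm (mat_apply a \<psi>) \<le> (real N * B) * vec_norm \<psi>" if \<psi>: "fin_vec \<psi>" for \<psi>
  proof -
    define S where "S = {s. \<psi> s \<noteq> 0} \<union> {s. mat_apply a \<psi> s \<noteq> 0}"
    have S: "finite S" "{s. \<psi> s \<noteq> 0} \<subseteq> S" "{s. mat_apply a \<psi> s \<noteq> 0} \<subseteq> S"
      using \<psi> fin_vec_apply[OF assms \<psi>] by (auto simp: S_def fin_vec_def)
    have row: "(cmod (mat_apply a \<psi> s))\<^sup>2 \<le> real N * B\<^sup>2 * (\<Sum>t\<in>S. if eq_off \<Lambda> s t then (cmod (\<psi> t))\<^sup>2 else 0)" for s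
    proof -
      let ?E = "{t. eq_off \<Lambda> s t}"
      have fE: "finite ?E" by (rule finite_eq_off[OF assms(1)])
      have "cmod (mat_apply a \<psi> s) \<le> (\<Sum>t\<in>?E. B * cmod (\<psi> t))"
        unfolding mat_apply_local[OF assms]
        by (rule order_trans[OF norm_sum sum_mono]) (auto simp: norm_mult intro: mult_right_mono B)
      also have "\<dots> = B * (\<Sum>t\<in>?E. cmod (\<psi> t))" by (simp add: sum_distrib_left)
      finally have "(cmod (mat_apply a \<psi> s))\<^sup>2 \<le> (B * (\<Sum>t\<in>?E. cmod (\<psi> t)))\<^sup>2"
        by (rule power_mono) simp
      also have "\<dots> = B\<^sup>2 * (\<Sum>t\<in>?E. cmod (\<psi> t))\<^sup>2" by (simp add: power_mult_distrib)
      also have "\<dots> \<le> B\<^sup>2 * (real N * (\<Sum>t\<in>?E. (cmod (\<psi> t))\<^sup>2))"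
        using sum_squared_le_sum_of_squares[of "\<lambda>t. cmod (\<psi> t)" ?E]
        by (intro mult_left_mono) (simp_all add: card_eq_off N_def mult.commute)
      also have "(\<Sum>t\<in>?E. (cmod (\<psi> t))\<^sup>2) = (\<Sum>t\<in>S \<inter> ?E. (cmod (\<psi> t))\<^sup>2)"
        using S fE by (intro sum.mono_neutral_right) auto
      also have "\<dots> = (\<Sum>t\<in>S. if eq_off \<Lambda> s t then (cmod (\<psi> t))\<^sup>2 else 0)"
        using S(1) by (simp add: sum.inter_restrict)
      finally show ?thesis by (simp add: mult_ac)
    qed
    have "(\<Sum>s\<in>S. (cmod (mat_apply a \<psi> s))\<^sup>2) \<le>
        (\<Sum>s\<in>S. real N * B\<^sup>2 * (\<Sum>t\<in>S. if eq_off \<Lambda> s t then (cmod (\<psi> t))\<^sup>2 else 0))"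
      by (rule sum_mono) (rule row)
    also have "\<dots> = real N * B\<^sup>2 * (\<Sum>t\<in>S. \<Sum>s\<in>S. if eq_off \<Lambda> s t then (cmod (\<psi> t))\<^sup>2 else 0)"
      by (subst sum.swap) (simp add: sum_distrib_left)
    also have "\<dots> \<le> real N * B\<^sup>2 * (\<Sum>t\<in>S. real N * (cmod (\<psi> t))\<^sup>2)"
    proof (intro mult_left_mono sum_mono)
      fix t
      have "(\<Sum>s\<in>S. if eq_off \<Lambda> s t then (cmod (\<psi> t))\<^sup>2 else 0) = real (card (S \<inter> {s. eq_off \<Lambda> t s})) * (cmod (\<psi> t))\<^sup>2"
        using S(1) sum.inter_restrict[OF S(1), of "\<lambda>_. (cmod (\<psi> t))\<^sup>2" "{s. eq_off \<Lambda> s t}"]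
        by (simp add: eq_off_sym[of \<Lambda> t])
      also have "\<dots> \<le> real N * (cmod (\<psi> t))\<^sup>2"
        using card_mono[OF finite_eq_off[OF assms(1), of t], of "S \<inter> {s. eq_off \<Lambda> t s}"]
        by (intro mult_right_mono) (auto simp: card_eq_off N_def)
      finally show "(\<Sum>s\<in>S. if eq_off \<Lambda> s t then (cmod (\<psi> t))\<^sup>2 else 0) \<le> real N * (cmod (\<psi> t))\<^sup>2" .
    qed simp
    also have "\<dots> = (real N * B)\<^sup>2 * (\<Sum>t\<in>S. (cmod (\<psi> t))\<^sup>2)"
      by (simp add: sum_distrib_left power2_eq_square mult_ac)
    finally have "L2_set (\<lambda>s. cmod (mat_apply a \<psi> s)) S \<le> sqrt ((real N * B)\<^sup>2 * (\<Sum>t\<in>S. (cmod (\<psi> t))\<^sup>2))"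
      unfolding L2_set_def by (rule real_sqrt_le_mono)
    also have "\<dots> = real N * B * L2_set (\<lambda>s. cmod (\<psi> s)) S"
      using B(2) by (simp add: real_sqrt_mult L2_set_def)
    finally show ?thesis using S by (simp add: vec_norm_eq[of S])
  qed
  show ?thesis by (rule that[of "real N * B"]) (use le B in auto)
qed

lemma mat_apply_scale: "mat_apply a (\<lambda>s. c * \<psi> s) = (\<lambda>s. c * mat_apply a \<psi> s)"
  by (simp add: mat_apply_def fun_eq_iff sum_distrib_left mult_ac)

lemma op_norm_bdd:
  assumes "finite \<Lambda>" "a \<in> local_mats \<Lambda>"
  shows "bdd_above ((\<lambda>\<psi>. vec_norm (mat_apply a \<psi>)) ` {\<psi>. fin_vec \<psi> \<and> vec_norm \<psi> \<le> 1})"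
proof -
  obtain K where K: "K \<ge> 0" "\<And>\<psi>. fin_vec \<psi> \<Longrightarrow> vec_norm (mat_apply a \<psi>) \<le> K * vec_norm \<psi>"
    using mat_apply_bounded[OF assms] by blast
  show ?thesis
  proof (rule bdd_aboveI2[where M=K])
    fix \<psi> :: "('a \<Rightarrow> 2) \<Rightarrow> complex" assume "\<psi> \<in> {\<psi>. fin_vec \<psi> \<and> vec_norm \<psi> \<le> 1}"
    then show "vec_norm (mat_apply a \<psi>) \<le> K"
      using K(2)[of \<psi>] mult_left_mono[of "vec_norm \<psi>" 1 K] K(1) by simp
  qed
qed

lemma op_norm_bound:
  assumes "finite \<Lambda>" "a \<in> local_mats \<Lambda>" "fin_vec \<psi>"
  shows "vec_norm (mat_apply a \<psi>) \<le> op_norm a * vec_norm \<psi>"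
proof (cases "vec_norm \<psi> = 0")
  case True
  then have "\<psi> = (\<lambda>_. 0)" using assms(3) by (simp add: vec_norm_eq_0)
  then show ?thesis by simp
next
  case False
  define c where "c = complex_of_real (inverse (vec_norm \<psi>))"
  have c: "cmod c = inverse (vec_norm \<psi>)" by (simp add: c_def norm_inverse)
  have "vec_norm (mat_apply a (\<lambda>s. c * \<psi> s)) \<le> op_norm a"
    unfolding op_norm_def using False assms(3)
    by (intro cSUP_upper op_norm_bdd[OF assms(1,2)]) (simp add: fin_vec_scale vec_norm_scale c)
  then have "inverse (vec_norm \<psi>) * vec_norm (mat_apply a \<psi>) \<le> op_norm a"
    by (simp add: mat_apply_scale vec_norm_scale fin_vec_apply[OF assms] c)
  with False show ?thesis by (simp add: field_simps less_le)
qed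

lemma op_norm_nonneg:
  assumes "finite \<Lambda>" "a \<in> local_mats \<Lambda>"
  shows "op_norm a \<ge> 0"
proof -
  have "vec_norm (mat_apply a (\<lambda>_. 0)) \<le> op_norm a"
    unfolding op_norm_def by (intro cSUP_upper op_norm_bdd[OF assms]) simp
  then show ?thesis by simp
qed

lemma op_norm_le:
  assumes "K \<ge> 0" "\<And>\<psi>. fin_vec \<psi> \<Longrightarrow> vec_norm (mat_apply a \<psi>) \<le> K * vec_norm \<psi>"
  shows "op_norm a \<le> K"
  unfolding op_norm_def
proof (rule cSUP_least)
  show "{\<psi>. fin_vec \<psi> \<and> vec_norm \<psi> \<le> 1} \<noteq> ({} :: ('a \<Rightarrow> complex) set)"
    by (auto intro!: exI[of _ "\<lambda>_. 0"])
  fix \<psi> :: "'a \<Rightarrow> complex" assume "\<psi> \<in> {\<psi>. fin_vec \<psi> \<and> vec_norm \<psi> \<le> 1}"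
  then show "vec_norm (mat_apply a \<psi>) \<le> K"
    using assms(2)[of \<psi>] mult_left_mono[of "vec_norm \<psi>" 1 K] assms(1) by simp
qed

lemma mat_apply_mult:
  assumes fin: "finite \<Lambda>" and a: "a \<in> local_mats \<Lambda>" and b: "b \<in> local_mats \<Lambda>"
  shows "mat_apply (mat_mult a b) \<psi> = mat_apply a (mat_apply b \<psi>)"
proof
  fix s
  let ?E = "{t. eq_off \<Lambda> s t}"
  have E: "{u. eq_off \<Lambda> t u} = ?E" if "t \<in> ?E" for t
    using that by (auto dest: eq_off_trans eq_off_sym[THEN iffD1])
  have "mat_apply (mat_mult a b) \<psi> s = (\<Sum>u\<in>?E. \<Sum>t\<in>?E. a s t * b t u * \<psi> u)"
    by (simp add: mat_apply_local[OF fin local_mats_mult[OF fin a b]] mat_mult_local[OF fin a] sum_distrib_right)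
  also have "\<dots> = (\<Sum>t\<in>?E. \<Sum>u\<in>?E. a s t * b t u * \<psi> u)" by (rule sum.swap)
  also have "\<dots> = (\<Sum>t\<in>?E. a s t * (\<Sum>u\<in>?E. b t u * \<psi> u))"
    by (simp add: sum_distrib_left mult.assoc)
  also have "\<dots> = (\<Sum>t\<in>?E. a s t * mat_apply b \<psi> t)"
    by (rule sum.cong[OF refl]) (simp only: mat_apply_local[OF fin b] E)
  also have "\<dots> = mat_apply a (mat_apply b \<psi>) s" by (simp add: mat_apply_local[OF fin a])
  finally show "mat_apply (mat_mult a b) \<psi> s = mat_apply a (mat_apply b \<psi>) s" .
qed

lemma mat_mult_column: "mat_mult a b s u = mat_apply a (\<lambda>t. b t u) s"
  by (simp add: mat_mult_def mat_apply_def)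

lemma mat_mult_assoc:
  assumes fin: "finite \<Lambda>" and a: "a \<in> local_mats \<Lambda>" and b: "b \<in> local_mats \<Lambda>"
  shows "mat_mult (mat_mult a b) c = mat_mult a (mat_mult b c)"
  by (simp add: fun_eq_iff mat_mult_column[of _ c] mat_apply_mult[OF assms] mat_mult_column[of a])

definition vec_inner :: "('i \<Rightarrow> complex) \<Rightarrow> ('i \<Rightarrow> complex) \<Rightarrow> complex"
  where "vec_inner \<phi> \<psi> = (\<Sum>s | \<phi> s \<noteq> 0. cnj (\<phi> s) * \<psi> s)"

lemma vec_inner_eq:
  assumes "finite S" "{s. \<phi> s \<noteq> 0} \<subseteq> S"
  shows "vec_inner \<phi> \<psi> = (\<Sum>s\<in>S. cnj (\<phi> s) * \<psi> s)"
  unfolding vec_inner_def using assms by (intro sum.mono_neutral_left) auto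

lemma vec_inner_self: "fin_vec \<psi> \<Longrightarrow> vec_inner \<psi> \<psi> = complex_of_real ((vec_norm \<psi>)\<^sup>2)"
  by (simp add: vec_inner_def vec_norm_def sum_nonneg mult.commute[of "cnj _"]
      flip: complex_norm_square)

lemma vec_inner_CS:
  assumes "fin_vec \<phi>" "fin_vec \<psi>"
  shows "cmod (vec_inner \<phi> \<psi>) \<le> vec_norm \<phi> * vec_norm \<psi>"
proof -
  define S where "S = {s. \<phi> s \<noteq> 0} \<union> {s. \<psi> s \<noteq> 0}"
  have S: "finite S" "{s. \<phi> s \<noteq> 0} \<subseteq> S" "{s. \<psi> s \<noteq> 0} \<subseteq> S"
    using assms by (auto simp: S_def fin_vec_def)
  have "cmod (vec_inner \<phi> \<psi>) \<le> (\<Sum>s\<in>S. \<bar>cmod (\<phi> s)\<bar> * \<bar>cmod (\<psi> s)\<bar>)"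
    unfolding vec_inner_eq[OF S(1,2)] by (rule order_trans[OF norm_sum]) (simp add: norm_mult)
  also have "\<dots> \<le> L2_set (\<lambda>s. cmod (\<phi> s)) S * L2_set (\<lambda>s. cmod (\<psi> s)) S"
    by (rule L2_set_mult_ineq)
  finally show ?thesis using S by (simp add: vec_norm_eq[of S])
qed

lemma vec_inner_adj:
  assumes fin: "finite \<Lambda>" and a: "a \<in> local_mats \<Lambda>" and "fin_vec \<phi>" "fin_vec \<psi>"
  shows "vec_inner (mat_apply a \<phi>) \<psi> = vec_inner \<phi> (mat_apply (\<lambda>s t. cnj (a t s)) \<psi>)"
proof -
  define S where "S = (\<Union>t\<in>{s. \<phi> s \<noteq> 0} \<union> {s. \<psi> s \<noteq> 0}. {s. eq_off \<Lambda> t s})"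
  have finS: "finite S" using assms by (auto simp: S_def fin_vec_def intro: finite_eq_off)
  have cl: "t \<in> S" if "s \<in> S" "eq_off \<Lambda> s t" for s t
    using that by (auto simp: S_def dest: eq_off_trans)
  have sub: "{s. \<phi> s \<noteq> 0} \<subseteq> S" "{s. \<psi> s \<noteq> 0} \<subseteq> S"
    by (auto simp: S_def intro: exI)
  have ap: "mat_apply b \<eta> s = (\<Sum>t\<in>S. b s t * \<eta> t)" if "b \<in> local_mats \<Lambda>" "s \<in> S" for b \<eta> s
    using that by (intro mat_apply_eq finS) (auto intro: cl dest: local_mats_eq_off)
  have "mat_apply a \<phi> s = 0" if "s \<notin> S" for s
  proof -
    have "\<phi> t = 0" if "eq_off \<Lambda> s t" for t
      using that \<open>s \<notin> S\<close> sub(1) cl[of t s] by (auto simp: eq_off_sym)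
    then show ?thesis by (simp add: mat_apply_local[OF fin a])
  qed
  then have "{s. mat_apply a \<phi> s \<noteq> 0} \<subseteq> S" by auto
  then have "vec_inner (mat_apply a \<phi>) \<psi> = (\<Sum>s\<in>S. \<Sum>t\<in>S. cnj (a s t) * cnj (\<phi> t) * \<psi> s)"
    by (simp add: vec_inner_eq[OF finS] ap[OF a] sum_distrib_right)
  also have "\<dots> = (\<Sum>t\<in>S. \<Sum>s\<in>S. cnj (a s t) * cnj (\<phi> t) * \<psi> s)" by (rule sum.swap)
  also have "\<dots> = vec_inner \<phi> (mat_apply (\<lambda>s t. cnj (a t s)) \<psi>)"
    by (simp add: vec_inner_eq[OF finS sub(1)] ap[OF local_mats_adj[OF a]] sum_distrib_left mult_ac)
  finally show ?thesis .
qed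

lemma op_norm_mult:
  assumes fin: "finite \<Lambda>" and a: "a \<in> local_mats \<Lambda>" and b: "b \<in> local_mats \<Lambda>"
  shows "op_norm (mat_mult a b) \<le> op_norm a * op_norm b"
proof (rule op_norm_le)
  note n = op_norm_nonneg[OF fin a] op_norm_nonneg[OF fin b]
  then show "op_norm a * op_norm b \<ge> 0" by simp
  fix \<psi> :: "('a \<Rightarrow> 2) \<Rightarrow> complex" assume \<psi>: "fin_vec \<psi>"
  have "vec_norm (mat_apply (mat_mult a b) \<psi>) \<le> op_norm a * vec_norm (mat_apply b \<psi>)"
    unfolding mat_apply_mult[OF assms] by (intro op_norm_bound[OF fin a] fin_vec_apply[OF fin b] \<psi>)
  also have "\<dots> \<le> op_norm a * (op_norm b * vec_norm \<psi>)"
    by (intro mult_left_mono op_norm_bound[OF fin b] \<psi> n)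
  finally show "vec_norm (mat_apply (mat_mult a b) \<psi>) \<le> op_norm a * op_norm b * vec_norm \<psi>"
    by (simp add: mult.assoc)
qed

lemma op_norm_cstar:
  assumes fin: "finite \<Lambda>" and a: "a \<in> local_mats \<Lambda>"
  shows "op_norm (mat_mult (\<lambda>s t. cnj (a t s)) a) = (op_norm a)\<^sup>2"
proof -
  have key: "(op_norm b)\<^sup>2 \<le> op_norm (mat_mult (\<lambda>s t. cnj (b t s)) b)" if b: "b \<in> local_mats \<Lambda>" for b
  proof -
    let ?b' = "\<lambda>s t. cnj (b t s)"
    note b' = local_mats_adj[OF b]
    note m = local_mats_mult[OF fin b' b]
    have "op_norm b \<le> sqrt (op_norm (mat_mult ?b' b))"
    proof (rule op_norm_le)
      show "0 \<le> sqrt (op_norm (mat_mult ?b' b))" using op_norm_nonneg[OF fin m] by simp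
      fix \<psi> :: "('a \<Rightarrow> 2) \<Rightarrow> complex" assume \<psi>: "fin_vec \<psi>"
      note f = fin_vec_apply[OF fin b \<psi>]
      have "(vec_norm (mat_apply b \<psi>))\<^sup>2 = cmod (vec_inner (mat_apply b \<psi>) (mat_apply b \<psi>))"
        by (simp add: vec_inner_self f norm_power)
      also have "\<dots> = cmod (vec_inner \<psi> (mat_apply (mat_mult ?b' b) \<psi>))"
        by (simp add: vec_inner_adj[OF fin b \<psi> f] mat_apply_mult[OF fin b' b])
      also have "\<dots> \<le> vec_norm \<psi> * vec_norm (mat_apply (mat_mult ?b' b) \<psi>)"
        by (intro vec_inner_CS \<psi> fin_vec_apply[OF fin m])
      also have "\<dots> \<le> vec_norm \<psi> * (op_norm (mat_mult ?b' b) * vec_norm \<psi>)"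
        by (intro mult_left_mono op_norm_bound[OF fin m] \<psi>) simp
      also have "\<dots> = (sqrt (op_norm (mat_mult ?b' b)) * vec_norm \<psi>)\<^sup>2"
        using op_norm_nonneg[OF fin m] by (simp add: power_mult_distrib power2_eq_square mult_ac)
      finally show "vec_norm (mat_apply b \<psi>) \<le> sqrt (op_norm (mat_mult ?b' b)) * vec_norm \<psi>"
        by (rule power2_le_imp_le) (simp add: op_norm_nonneg[OF fin m])
    qed
    then have "(op_norm b)\<^sup>2 \<le> (sqrt (op_norm (mat_mult ?b' b)))\<^sup>2"
      by (rule power_mono) (rule op_norm_nonneg[OF fin b])
    then show ?thesis using op_norm_nonneg[OF fin m] by simp
  qed
  have le: "op_norm b \<le> op_norm (\<lambda>s t. cnj (b t s))" if b: "b \<in> local_mats \<Lambda>" for b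
  proof (cases "op_norm b = 0")
    case True
    then show ?thesis using op_norm_nonneg[OF fin local_mats_adj[OF b]] by simp
  next
    case False
    have "op_norm b * op_norm b \<le> op_norm (\<lambda>s t. cnj (b t s)) * op_norm b"
      using key[OF b] op_norm_mult[OF fin local_mats_adj[OF b] b] by (simp add: power2_eq_square)
    with False op_norm_nonneg[OF fin b] show ?thesis by simp
  qed
  have "op_norm (\<lambda>s t. cnj (a t s)) \<le> op_norm a" using le[OF local_mats_adj[OF a]] by simp
  then have "op_norm (\<lambda>s t. cnj (a t s)) * op_norm a \<le> (op_norm a)\<^sup>2"
    using op_norm_nonneg[OF fin a] by (simp add: power2_eq_square mult_right_mono)
  then show ?thesis
    using key[OF a] op_norm_mult[OF fin local_mats_adj[OF a] a] by linarith
qed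

lemma mat_apply_one: "mat_apply (\<lambda>s t. if s = t then 1 else 0) \<psi> = \<psi>"
  by (simp add: fun_eq_iff mat_apply_eq[where F="{_}"])

definition delta_vec :: "'i \<Rightarrow> 'i \<Rightarrow> complex" where "delta_vec t = (\<lambda>s. if s = t then 1 else 0)"

lemma delta_vec: "fin_vec (delta_vec t)" "vec_norm (delta_vec t) = 1"
  by (simp_all add: fin_vec_def delta_vec_def vec_norm_def)

lemma op_norm_one: "op_norm (\<lambda>s t :: 'e \<Rightarrow> 2. if s = t then 1 else 0) = 1"
proof (rule antisym)
  let ?I = "\<lambda>s t :: 'e \<Rightarrow> 2. if s = t then 1 else 0"
  show "op_norm ?I \<le> 1"
    by (rule op_norm_le) (simp_all add: mat_apply_one)
  show "1 \<le> op_norm ?I"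
    using op_norm_bound[OF finite.emptyI local_mats_one, of "delta_vec undefined"]
    by (simp add: mat_apply_one delta_vec)
qed

lemma op_norm_eq_0:
  assumes fin: "finite \<Lambda>" and a: "a \<in> local_mats \<Lambda>"
  shows "op_norm a = 0 \<longleftrightarrow> a = (\<lambda>_ _. 0)"
proof
  assume 0: "op_norm a = 0"
  have "a s t = 0" for s t
  proof -
    have "vec_norm (mat_apply a (delta_vec t)) = 0"
      using op_norm_bound[OF fin a delta_vec(1), of t] 0 by (simp add: antisym)
    then have "mat_apply a (delta_vec t) s = 0"
      by (simp add: vec_norm_eq_0 fin_vec_apply[OF fin a delta_vec(1)])
    moreover have "mat_apply a (delta_vec t) s = a s t"
      by (subst mat_apply_eq[where F="{t. a s t \<noteq> 0} \<union> {t}"])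
        (auto simp: local_mats_finite_row[OF fin a] delta_vec_def if_distrib cong: if_cong)
    ultimately show ?thesis by simp
  qed
  then show "a = (\<lambda>_ _. 0)" by blast
next
  assume "a = (\<lambda>_ _. 0)"
  then have "op_norm a \<le> 0"
    by (intro op_norm_le) (simp_all add: mat_apply_def[abs_def])
  then show "op_norm a = 0" using op_norm_nonneg[OF fin a] by simp
qed

lemma op_norm_add:
  assumes fin: "finite \<Lambda>" and a: "a \<in> local_mats \<Lambda>" and b: "b \<in> local_mats \<Lambda>"
  shows "op_norm (\<lambda>s t. a s t + b s t) \<le> op_norm a + op_norm b"
proof (rule op_norm_le)
  show "op_norm a + op_norm b \<ge> 0" using op_norm_nonneg[OF fin a] op_norm_nonneg[OF fin b] by simp
  fix \<psi> :: "('a \<Rightarrow> 2) \<Rightarrow> complex" assume \<psi>: "fin_vec \<psi>"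
  have "mat_apply (\<lambda>s t. a s t + b s t) \<psi> = (\<lambda>s. mat_apply a \<psi> s + mat_apply b \<psi> s)"
    by (simp add: fun_eq_iff mat_apply_local[OF fin a] mat_apply_local[OF fin b]
      mat_apply_local[OF fin local_mats_add[OF a b]] distrib_right sum.distrib)
  then have "vec_norm (mat_apply (\<lambda>s t. a s t + b s t) \<psi>) \<le> vec_norm (mat_apply a \<psi>) + vec_norm (mat_apply b \<psi>)"
    by (simp add: vec_norm_triangle fin_vec_apply[OF fin a \<psi>] fin_vec_apply[OF fin b \<psi>])
  also have "\<dots> \<le> op_norm a * vec_norm \<psi> + op_norm b * vec_norm \<psi>"
    by (intro add_mono op_norm_bound[OF fin a \<psi>] op_norm_bound[OF fin b \<psi>])
  finally show "vec_norm (mat_apply (\<lambda>s t. a s t + b s t) \<psi>) \<le> (op_norm a + op_norm b) * vec_norm \<psi>"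
    by (simp add: distrib_right)
qed

lemma op_norm_scale:
  assumes fin: "finite \<Lambda>" and a: "a \<in> local_mats \<Lambda>"
  shows "op_norm (\<lambda>s t. c * a s t) = cmod c * op_norm a"
proof -
  have le: "op_norm (\<lambda>s t. d * b s t) \<le> cmod d * op_norm b" if b: "b \<in> local_mats \<Lambda>" for d b
  proof (rule op_norm_le)
    show "cmod d * op_norm b \<ge> 0" using op_norm_nonneg[OF fin b] by simp
    fix \<psi> :: "('a \<Rightarrow> 2) \<Rightarrow> complex" assume \<psi>: "fin_vec \<psi>"
    have "mat_apply (\<lambda>s t. d * b s t) \<psi> = (\<lambda>s. d * mat_apply b \<psi> s)"
      by (simp add: fun_eq_iff mat_apply_local[OF fin b]
        mat_apply_local[OF fin local_mats_scale[OF b]] sum_distrib_left mult_ac)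
    then show "vec_norm (mat_apply (\<lambda>s t. d * b s t) \<psi>) \<le> cmod d * op_norm b * vec_norm \<psi>"
      using op_norm_bound[OF fin b \<psi>]
      by (simp add: vec_norm_scale fin_vec_apply[OF fin b \<psi>] mult.assoc mult_left_mono)
  qed
  show ?thesis
  proof (cases "c = 0")
    case True
    then show ?thesis using op_norm_eq_0[OF fin local_mats_zero] by simp
  next
    case False
    have "op_norm a \<le> cmod (inverse c) * op_norm (\<lambda>s t. c * a s t)"
      using le[OF local_mats_scale[OF a], of "inverse c" c] False by (simp flip: mult.assoc)
    then have "cmod c * op_norm a \<le> op_norm (\<lambda>s t. c * a s t)"
      using False by (simp add: norm_inverse norm_divide field_simps)
    with le[OF a, of c] show ?thesis by simp
  qed
qed

text \<open>The union of the local algebras over all finite sets of sites.\<close>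

typedef 'e local_alg = "\<Union>\<Lambda>\<in>{\<Lambda> :: 'e set. finite \<Lambda>}. local_mats \<Lambda>"
  morphisms entries Abs_local_alg
  using local_mats_zero by blast

setup_lifting type_definition_local_alg

abbreviation is_local :: "(('e \<Rightarrow> 2) \<Rightarrow> ('e \<Rightarrow> 2) \<Rightarrow> complex) \<Rightarrow> bool"
  where "is_local a \<equiv> a \<in> (\<Union>\<Lambda>\<in>{\<Lambda> :: 'e set. finite \<Lambda>}. local_mats \<Lambda>)"

lemma is_local1:
  assumes "is_local a"
  obtains \<Lambda> where "finite \<Lambda>" "a \<in> local_mats \<Lambda>"
  using assms by blast

lemma is_local2:
  assumes "is_local a" "is_local b"
  obtains \<Lambda> where "finite \<Lambda>" "a \<in> local_mats \<Lambda>" "b \<in> local_mats \<Lambda>"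
proof -
  obtain A B where "finite A" "a \<in> local_mats A" "finite B" "b \<in> local_mats B"
    using assms by blast
  then show ?thesis
    using that[of "A \<union> B"] local_mats_mono[of A "A \<union> B"] local_mats_mono[of B "A \<union> B"] by auto
qed

lemma is_local3:
  assumes "is_local a" "is_local b" "is_local c"
  obtains \<Lambda> where "finite \<Lambda>" "a \<in> local_mats \<Lambda>" "b \<in> local_mats \<Lambda>" "c \<in> local_mats \<Lambda>"
proof -
  obtain A where A: "finite A" "a \<in> local_mats A" "b \<in> local_mats A" using assms(1,2) by (rule is_local2)
  obtain B where B: "finite B" "c \<in> local_mats B" using assms(3) by blast
  then show ?thesis
    using A that[of "A \<union> B"] local_mats_mono[of A "A \<union> B"] local_mats_mono[of B "A \<union> B"] by auto
qed

instantiation local_alg :: (type) pre_cstar_algebra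
begin

lift_definition zero_local_alg :: "'a local_alg" is "\<lambda>_ _. 0"
  using local_mats_zero by blast
lift_definition one_local_alg :: "'a local_alg" is "\<lambda>s t. if s = t then 1 else 0"
  using local_mats_one by blast
lift_definition plus_local_alg :: "'a local_alg \<Rightarrow> 'a local_alg \<Rightarrow> 'a local_alg"
  is "\<lambda>a b s t. a s t + b s t"
  by (erule (1) is_local2) (blast intro: local_mats_add)
lift_definition scaleC_local_alg :: "complex \<Rightarrow> 'a local_alg \<Rightarrow> 'a local_alg"
  is "\<lambda>c a s t. c * a s t"
  by (blast intro: local_mats_scale)
definition uminus_local_alg :: "'a local_alg \<Rightarrow> 'a local_alg"
  where "uminus_local_alg a = (- 1) *\<^sub>C a"
definition minus_local_alg :: "'a local_alg \<Rightarrow> 'a local_alg \<Rightarrow> 'a local_alg"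
  where "minus_local_alg a b = a + - b"
definition scaleR_local_alg :: "real \<Rightarrow> 'a local_alg \<Rightarrow> 'a local_alg"
  where "scaleR_local_alg r a = complex_of_real r *\<^sub>C a"
lift_definition times_local_alg :: "'a local_alg \<Rightarrow> 'a local_alg \<Rightarrow> 'a local_alg"
  is mat_mult
  by (erule (1) is_local2) (blast intro: local_mats_mult)
lift_definition adj_local_alg :: "'a local_alg \<Rightarrow> 'a local_alg" is "\<lambda>a s t. cnj (a t s)"
  by (blast intro: local_mats_adj)
lift_definition norm_local_alg :: "'a local_alg \<Rightarrow> real" is op_norm .
definition sgn_local_alg :: "'a local_alg \<Rightarrow> 'a local_alg"
  where "sgn_local_alg x = inverse (norm x) *\<^sub>R x"
definition dist_local_alg :: "'a local_alg \<Rightarrow> 'a local_alg \<Rightarrow> real"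
  where "dist_local_alg x y = norm (x - y)"
definition
  "(uniformity :: ('a local_alg \<times> 'a local_alg) filter) = (INF e\<in>{0 <..}. principal {(x, y). dist x y < e})"
definition open_local_alg :: "'a local_alg set \<Rightarrow> bool"
  where "open_local_alg S = (\<forall>x\<in>S. \<forall>\<^sub>F (x', y) in uniformity. x' = x \<longrightarrow> y \<in> S)"

instance
proof
  fix x y z :: "'a local_alg" and c d :: complex and r q :: real
  show "x + y + z = x + (y + z)" by transfer (simp add: add.assoc)
  show "x + y = y + x" by transfer (simp add: add.commute)
  show "0 + x = x" by transfer simp
  show "- x + x = 0" unfolding uminus_local_alg_def by transfer simp
  show "x - y = x + - y" by (rule minus_local_alg_def)
  show "x * y * z = x * (y * z)"
    by transfer (erule (1) is_local2, rule mat_mult_assoc)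
  show "1 * x = x" by transfer (intro ext, simp only: mat_mult_column mat_apply_one)
  show "x * 1 = x"
  proof transfer
    fix a :: "('a \<Rightarrow> 2) \<Rightarrow> ('a \<Rightarrow> 2) \<Rightarrow> complex" assume "is_local a"
    then have "finite {t. a s t \<noteq> 0}" for s by (auto intro: local_mats_finite_row)
    moreover have "a s t * (if t = u then 1 else 0) = (if t = u then a s t else 0)" for s t u
      by simp
    ultimately show "mat_mult a (\<lambda>s t. if s = t then 1 else 0) = a"
      by (intro ext) (simp only: mat_mult_def sum.delta, simp)
  qed
  show "(x + y) * z = x * z + y * z"
  proof transfer
    fix a b c :: "('a \<Rightarrow> 2) \<Rightarrow> ('a \<Rightarrow> 2) \<Rightarrow> complex" assume "is_local a" "is_local b"
    then obtain \<Lambda> where L: "finite \<Lambda>" "a \<in> local_mats \<Lambda>" "b \<in> local_mats \<Lambda>" by (rule is_local2)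
    show "mat_mult (\<lambda>s t. a s t + b s t) c = (\<lambda>s t. mat_mult a c s t + mat_mult b c s t)"
      by (simp add: fun_eq_iff mat_mult_local[OF L(1,2)] mat_mult_local[OF L(1,3)]
        mat_mult_local[OF L(1) local_mats_add[OF L(2,3)]] distrib_right sum.distrib)
  qed
  show "x * (y + z) = x * y + x * z"
    by transfer (simp add: fun_eq_iff mat_mult_def distrib_left sum.distrib)
  have n1: "norm (1::'a local_alg) = 1" by transfer (rule op_norm_one)
  then show "norm (1::'a local_alg) = 1" .
  have n0: "norm (0::'a local_alg) = 0" by transfer (simp add: op_norm_eq_0[OF finite.emptyI local_mats_zero])
  show "(0::'a local_alg) \<noteq> 1" using n1 n0 by auto
  have addr: "c *\<^sub>C (x + y) = c *\<^sub>C x + c *\<^sub>C y" for c and x y :: "'a local_alg"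
    by transfer (simp add: distrib_left)
  have addl: "(c + d) *\<^sub>C x = c *\<^sub>C x + d *\<^sub>C x" for c d and x :: "'a local_alg"
    by transfer (simp add: distrib_right)
  have sc: "c *\<^sub>C d *\<^sub>C x = (c * d) *\<^sub>C x" for c d and x :: "'a local_alg"
    by transfer (simp add: mult.assoc)
  have onec: "1 *\<^sub>C x = x" for x :: "'a local_alg"
    by transfer simp
  have ml: "(c *\<^sub>C x) * y = c *\<^sub>C (x * y)" for c and x y :: "'a local_alg"
  proof transfer
    fix c and a b :: "('a \<Rightarrow> 2) \<Rightarrow> ('a \<Rightarrow> 2) \<Rightarrow> complex" assume "is_local a"
    then obtain \<Lambda> where L: "finite \<Lambda>" "a \<in> local_mats \<Lambda>" by (rule is_local1)
    show "mat_mult (\<lambda>s t. c * a s t) b = (\<lambda>s t. c * mat_mult a b s t)"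
      by (simp add: fun_eq_iff mat_mult_local[OF L] mat_mult_local[OF L(1) local_mats_scale[OF L(2)]]
        sum_distrib_left mult.assoc)
  qed
  have mr: "x * (c *\<^sub>C y) = c *\<^sub>C (x * y)" for c and x y :: "'a local_alg"
    by transfer (simp add: mat_mult_def fun_eq_iff sum_distrib_left mult_ac)
  have ns: "norm (c *\<^sub>C x) = cmod c * norm x" for c and x :: "'a local_alg"
    by transfer (auto intro: op_norm_scale)
  show "c *\<^sub>C (x + y) = c *\<^sub>C x + c *\<^sub>C y" by (rule addr)
  show "(c + d) *\<^sub>C x = c *\<^sub>C x + d *\<^sub>C x" by (rule addl)
  show "c *\<^sub>C d *\<^sub>C x = (c * d) *\<^sub>C x" by (rule sc)
  show "r *\<^sub>R x = complex_of_real r *\<^sub>C x" by (rule scaleR_local_alg_def)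
  show "(c *\<^sub>C x) * y = c *\<^sub>C (x * y)" by (rule ml)
  show "x * (c *\<^sub>C y) = c *\<^sub>C (x * y)" by (rule mr)
  show "norm (c *\<^sub>C x) = cmod c * norm x" by (rule ns)
  show "r *\<^sub>R (x + y) = r *\<^sub>R x + r *\<^sub>R y" "(r + q) *\<^sub>R x = r *\<^sub>R x + q *\<^sub>R x"
    "r *\<^sub>R q *\<^sub>R x = (r * q) *\<^sub>R x" "1 *\<^sub>R x = x"
    "r *\<^sub>R x * y = r *\<^sub>R (x * y)" "x * r *\<^sub>R y = r *\<^sub>R (x * y)" "norm (r *\<^sub>R x) = \<bar>r\<bar> * norm x"
    by (simp_all add: scaleR_local_alg_def addr addl sc onec ml mr ns)
  show "adj (adj x) = x" by transfer simp
  show "adj (x + y) = adj x + adj y" by transfer simp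
  show "adj (c *\<^sub>C x) = cnj c *\<^sub>C adj x" by transfer simp
  show "adj (x * y) = adj y * adj x"
  proof transfer
    fix a b :: "('a \<Rightarrow> 2) \<Rightarrow> ('a \<Rightarrow> 2) \<Rightarrow> complex" assume "is_local a" "is_local b"
    then obtain \<Lambda> where L: "finite \<Lambda>" "a \<in> local_mats \<Lambda>" "b \<in> local_mats \<Lambda>" by (rule is_local2)
    have E: "{u. eq_off \<Lambda> s u} = {u. eq_off \<Lambda> t u}" if "eq_off \<Lambda> s t" for s t
      using that by (auto dest: eq_off_trans eq_off_sym[THEN iffD1])
    have "mat_mult a b t s = (\<Sum>u | eq_off \<Lambda> s u. a t u * b u s)" for s t
    proof (cases "eq_off \<Lambda> s t")
      case True then show ?thesis by (simp add: mat_mult_local[OF L(1,2)] E)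
    next
      case False
      have "a t u * b u s = 0" for u
        using False local_mats_eq_off[OF L(2), of t u] local_mats_eq_off[OF L(3), of u s]
        by (auto dest: eq_off_trans eq_off_sym[THEN iffD1])
      then show ?thesis by (simp only: mat_mult_local[OF L(1,2)] sum.neutral_const)
    qed
    then show "(\<lambda>s t. cnj (mat_mult a b t s)) = mat_mult (\<lambda>s t. cnj (b t s)) (\<lambda>s t. cnj (a t s))"
      by (simp add: fun_eq_iff mat_mult_local[OF L(1) local_mats_adj[OF L(3)]] mult.commute)
  qed
  show "norm (adj x * x) = (norm x)\<^sup>2"
    by transfer (auto intro: op_norm_cstar)
  show "norm (x + y) \<le> norm x + norm y"
    by transfer (erule (1) is_local2, rule op_norm_add)
  show "norm (x * y) \<le> norm x * norm y"
    by transfer (erule (1) is_local2, rule op_norm_mult)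
  show "norm x = 0 \<longleftrightarrow> x = 0"
    by transfer (auto simp: op_norm_eq_0)
  show "dist x y = norm (x - y)" by (rule dist_local_alg_def)
  show "sgn x = inverse (norm x) *\<^sub>R x" by (rule sgn_local_alg_def)
qed (rule uniformity_local_alg_def open_local_alg_def)+

end

text \<open>The matrix \<open>m\<close> placed at the site \<open>e\<close>. Products over distinct sites are elementary tensors.\<close>

lift_definition site_op :: "'e \<Rightarrow> complex^2^2 \<Rightarrow> 'e local_alg"
  is "\<lambda>e m s t. if eq_off {e} s t then m $ s e $ t e else 0"
proof -
  fix e :: 'e and m :: "complex^2^2"
  have "(\<lambda>s t. if eq_off {e} s t then m $ s e $ t e else 0) \<in> local_mats {e}"
    by (rule local_matsI[where M="\<lambda>p q. m $ p e $ q e"]) simp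
  then show "is_local (\<lambda>s t. if eq_off {e} s t then m $ s e $ t e else 0)" by blast
qed

lemma entries_site_op_mult:
  assumes "e \<noteq> f"
  shows "entries (site_op e m * site_op f n) s u =
    (if eq_off {e, f} s u then (m $ s e $ u e) * (n $ s f $ u f) else 0)"
  using assms
proof (transfer fixing: e f m n s u)
  let ?a = "\<lambda>s t. if eq_off {e} s t then m $ s e $ t e else 0"
  let ?b = "\<lambda>s t. if eq_off {f} s t then n $ s f $ t f else 0"
  assume ef: "e \<noteq> f"
  have 1: "mat_mult ?a ?b s u = (\<Sum>t | eq_off {e} s t. ?a s t * ?b t u)"
    by (rule mat_mult_eq) (auto simp: finite_eq_off)
  have 2: "(if t = s(e := u e) then (m $ s e $ u e) * ?b t u else 0) = ?a s t * ?b t u" if "eq_off {e} s t" for t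
  proof (cases "t e = u e")
    case True
    then have "t = s(e := u e)" using that by (auto simp: eq_off_def fun_eq_iff)
    then show ?thesis using that by simp
  next
    case False
    then have "\<not> eq_off {f} t u" using ef by (auto simp: eq_off_def)
    moreover have "t \<noteq> s(e := u e)" using False by auto
    ultimately show ?thesis by simp
  qed
  have "mat_mult ?a ?b s u = (\<Sum>t | eq_off {e} s t. if t = s(e := u e) then (m $ s e $ u e) * ?b t u else 0)"
    unfolding 1 using 2 by (intro sum.cong) auto
  also have "\<dots> = (m $ s e $ u e) * ?b (s(e := u e)) u"
    by (simp only: sum.delta finite_eq_off finite.intros) (auto simp: eq_off_def)
  also have "eq_off {f} (s(e := u e)) u \<longleftrightarrow> eq_off {e, f} s u"
    by (auto simp: eq_off_def)
  finally show "mat_mult ?a ?b s u = (if eq_off {e, f} s u then (m $ s e $ u e) * (n $ s f $ u f) else 0)"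
    using ef by simp
qed

lemma site_op_commute:
  assumes "e \<noteq> f"
  shows "site_op e m * site_op f n = site_op f n * site_op e m"
proof -
  have "entries (site_op e m * site_op f n) = entries (site_op f n * site_op e m)"
    using assms by (intro ext) (simp add: entries_site_op_mult insert_commute mult.commute)
  then show ?thesis by (simp add: entries_inject)
qed

text \<open>Finite products of pairwise commuting elements (order-independent by \<open>comm_prod_insert\<close>).\<close>

definition comm_prod :: "('i \<Rightarrow> 'a::monoid_mult) \<Rightarrow> 'i set \<Rightarrow> 'a"
  where "comm_prod f S = Finite_Set.fold (\<lambda>i x. f i * x) 1 S"

lemma comm_prod_insert:
  assumes "\<And>i j. f i * f j = f j * f i" "finite S" "i \<notin> S"
  shows "comm_prod f (insert i S) = f i * comm_prod f S"
proof -
  interpret comp_fun_commute "\<lambda>i x. f i * x"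
    by unfold_locales (simp add: fun_eq_iff assms(1) flip: mult.assoc)
  show ?thesis using assms(2,3) by (simp add: comm_prod_def)
qed

subsection \<open>Regular masas\<close>

definition sub_cstar_algebra :: "'a::cstar_algebra set \<Rightarrow> bool"
  where "sub_cstar_algebra B \<longleftrightarrow> 0 \<in> B \<and> (\<forall>x\<in>B. \<forall>y\<in>B. x + y \<in> B \<and> x * y \<in> B) \<and>
    (\<forall>c. \<forall>x\<in>B. c *\<^sub>C x \<in> B) \<and> (\<forall>x\<in>B. adj x \<in> B) \<and> closed B"

definition cstar_generated :: "'a::cstar_algebra set \<Rightarrow> 'a set"
  where "cstar_generated S = \<Inter>{B. sub_cstar_algebra B \<and> S \<subseteq> B}"

definition relative_commutant :: "'a::cstar_algebra set \<Rightarrow> 'a set"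
  where "relative_commutant B = {x. \<forall>b\<in>B. x * b = b * x}"

definition masa :: "'a::cstar_algebra set \<Rightarrow> bool"
  where "masa B \<longleftrightarrow> sub_cstar_algebra B \<and> (\<forall>x\<in>B. \<forall>y\<in>B. x * y = y * x) \<and> relative_commutant B = B"

definition normalizers :: "'a::cstar_algebra set \<Rightarrow> 'a set"
  where "normalizers B = {n. (\<lambda>b. adj n * b * n) ` B \<subseteq> B \<and> (\<lambda>b. n * b * adj n) ` B \<subseteq> B}"

definition regular_masa :: "'a::cstar_algebra set \<Rightarrow> bool"
  where "regular_masa B \<longleftrightarrow> masa B \<and> cstar_generated (normalizers B) = UNIV"

subsection \<open>The square lattice and its star and face operators\<close>

type_synonym vertex = "int \<times> int"

definition adjacent :: "vertex \<Rightarrow> vertex \<Rightarrow> bool"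
  where "adjacent u v \<longleftrightarrow> \<bar>fst u - fst v\<bar> + \<bar>snd u - snd v\<bar> = 1"

typedef edge = "{{u, v} |u v. adjacent u v}"
  morphisms endpoints Abs_edge
proof -
  have "adjacent (0, 0) (1, 0)" by (simp add: adjacent_def)
  then show ?thesis by blast
qed

text \<open>A face is named by its lower left corner.\<close>

type_synonym face = "int \<times> int"

fun corners :: "face \<Rightarrow> vertex set"
  where "corners (i, j) = {(i, j), (i + 1, j), (i, j + 1), (i + 1, j + 1)}"

definition star_edges :: "vertex \<Rightarrow> edge set"
  where "star_edges v = {e. v \<in> endpoints e}"

definition face_edges :: "face \<Rightarrow> edge set"
  where "face_edges p = {e. endpoints e \<subseteq> corners p}"

definition sigma_x :: "complex^2^2"
  where "sigma_x = vector [vector [0, 1], vector [1, 0]]"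

definition sigma_z :: "complex^2^2"
  where "sigma_z = vector [vector [1, 0], vector [0, - 1]]"

text \<open>The algebra \<open>A\<close> of the infinite system is \<open>edge quasi_local\<close>.\<close>

type_synonym 'e quasi_local = "'e local_alg completion"

definition pauli :: "complex^2^2 \<Rightarrow> 'e \<Rightarrow> 'e quasi_local"
  where "pauli m e = of_pre (site_op e m)"

definition star_op :: "vertex \<Rightarrow> edge quasi_local"
  where "star_op v = comm_prod (pauli sigma_x) (star_edges v)"

definition face_op :: "face \<Rightarrow> edge quasi_local"
  where "face_op p = comm_prod (pauli sigma_z) (face_edges p)"

lemma of_pre_mult: "of_pre (a * b) = of_pre a * of_pre b"
  by transfer (simp add: compl_rel_def)

lemma pauli_commute: "pauli m e * pauli m f = pauli m f * pauli m e"
  by (cases "e = f") (simp_all add: pauli_def site_op_commute flip: of_pre_mult)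

text \<open>The definitions in coordinates.\<close>

definition edge :: "vertex \<Rightarrow> vertex \<Rightarrow> edge" where "edge u v = Abs_edge {u, v}"

lemma endpoints_edge: "adjacent u v \<Longrightarrow> endpoints (edge u v) = {u, v}"
  unfolding edge_def by (rule Abs_edge_inverse) blast

lemma edge_cases:
  obtains u v where "adjacent u v" "endpoints e = {u, v}" "e = edge u v"
  using endpoints[of e] endpoints_inverse[of e] by (auto simp: edge_def)

lemma star_edges_eq:
  "star_edges (i, j) =
    {edge (i, j) (i + 1, j), edge (i, j) (i, j + 1), edge (i - 1, j) (i, j), edge (i, j - 1) (i, j)}"
    (is "_ = ?R")
proof
  show "?R \<subseteq> star_edges (i, j)"
    by (auto simp: star_edges_def endpoints_edge adjacent_def)
  show "star_edges (i, j) \<subseteq> ?R"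
  proof
    fix e assume "e \<in> star_edges (i, j)"
    then obtain w where w: "adjacent (i, j) w" "e = edge (i, j) w"
    proof (cases e rule: edge_cases)
      case (1 u v)
      then have "(i, j) = u \<or> (i, j) = v" using \<open>e \<in> star_edges (i, j)\<close> by (auto simp: star_edges_def)
      then show ?thesis
      proof
        assume "(i, j) = u" then show ?thesis using 1 that by blast
      next
        assume ij: "(i, j) = v"
        have "adjacent v u" using 1(1) by (simp add: adjacent_def abs_minus_commute)
        moreover have "edge u v = edge v u" by (simp add: edge_def insert_commute)
        ultimately show ?thesis using 1(3) ij that by metis
      qed
    qed
    obtain k l where kl: "w = (k, l)" by (cases w)
    have "w = (i + 1, j) \<or> w = (i, j + 1) \<or> w = (i - 1, j) \<or> w = (i, j - 1)"
      using w(1) unfolding kl adjacent_def by simp presburger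
    with w(2) show "e \<in> ?R" by (auto simp: edge_def insert_commute)
  qed
qed

lemma face_edges_eq:
  "face_edges (i, j) =
    {edge (i, j) (i + 1, j), edge (i, j) (i, j + 1), edge (i, j + 1) (i + 1, j + 1), edge (i + 1, j) (i + 1, j + 1)}"
    (is "_ = ?R")
proof
  show "?R \<subseteq> face_edges (i, j)"
    by (auto simp: face_edges_def endpoints_edge adjacent_def)
  show "face_edges (i, j) \<subseteq> ?R"
  proof
    fix e assume e: "e \<in> face_edges (i, j)"
    obtain u v where uv: "adjacent u v" "endpoints e = {u, v}" "e = edge u v"
      by (rule edge_cases)
    have "u \<in> corners (i, j)" "v \<in> corners (i, j)"
      using e uv(2) by (auto simp: face_edges_def)
    with uv(1,3) show "e \<in> ?R" by (auto simp: adjacent_def edge_def insert_commute)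
  qed
qed

lemma edge_eq_iff:
  assumes "adjacent u v" "adjacent u' v'"
  shows "edge u v = edge u' v' \<longleftrightarrow> {u, v} = {u', v'}"
  using endpoints_edge[OF assms(1)] endpoints_edge[OF assms(2)] endpoints_inject by metis

lemma comm_prod_pauli4:
  assumes "distinct [a, b, c, d]"
  shows "comm_prod (pauli m) {a, b, c, d} = pauli m a * pauli m b * pauli m c * pauli m d"
proof -
  have "comm_prod (pauli m) {} = (1 :: 'a quasi_local)" by (simp add: comm_prod_def)
  then show ?thesis
    using assms by (simp add: comm_prod_insert pauli_commute mult.assoc)
qed

lemma star_op_eq:
  "star_op (i, j) = pauli sigma_x (edge (i, j) (i + 1, j)) * pauli sigma_x (edge (i, j) (i, j + 1)) *
     pauli sigma_x (edge (i - 1, j) (i, j)) * pauli sigma_x (edge (i, j - 1) (i, j))"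
  unfolding star_op_def star_edges_eq
  by (rule comm_prod_pauli4) (auto simp: edge_eq_iff adjacent_def doubleton_eq_iff)

lemma face_op_eq:
  "face_op (i, j) = pauli sigma_z (edge (i, j) (i + 1, j)) * pauli sigma_z (edge (i, j) (i, j + 1)) *
     pauli sigma_z (edge (i, j + 1) (i + 1, j + 1)) * pauli sigma_z (edge (i + 1, j) (i + 1, j + 1))"
  unfolding face_op_def face_edges_eq
  by (rule comm_prod_pauli4) (auto simp: edge_eq_iff adjacent_def doubleton_eq_iff)

end

theory Submission
  imports Defs
begin

text \<open>The Pauli words \<open>X\<^sub>S Z\<^sub>T\<close> span a dense subspace, and each of them commutes or anticommutes with
  every star and every face operator. Averaging \<open>x \<mapsto> (x + g x g) / 2\<close> over a generator \<open>g\<close> is a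
  contraction that fixes the commutant, the words commuting with \<open>g\<close>, and kills the words
  anticommuting with \<open>g\<close>. So an element commuting with all generators is a limit of combinations of
  words for which \<open>T\<close> meets every star and \<open>S\<close> meets every face in an even number of edges. As the
  plane has no first homology, \<open>T\<close> is then a sum modulo 2 of faces and \<open>S\<close> a sum of stars, so these
  words belong to the algebra of star and face operators. It is regular because conjugation by a Pauli
  matrix maps every generator to itself or its negative.\<close>

section \<open>Sub-C*-algebras\<close>

lemma scaleC_one: "1 *\<^sub>C x = (x :: 'a::pre_cstar_algebra)"
  using scaleR_eq_scaleC[of 1 x] by simp

lemma scaleC_scaleR: "c *\<^sub>C r *\<^sub>R x = r *\<^sub>R c *\<^sub>C (x :: 'a::pre_cstar_algebra)"
  by (simp add: scaleR_eq_scaleC scaleC_scaleC mult.commute)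

lemma linear_scaleC: "linear (\<lambda>x. c *\<^sub>C (x :: 'a::pre_cstar_algebra))"
  by (rule linearI) (simp_all add: scaleC_add_right scaleC_scaleR)

lemma sub_cstar_algebraD:
  assumes "sub_cstar_algebra B"
  shows "0 \<in> B" "x \<in> B \<Longrightarrow> y \<in> B \<Longrightarrow> x + y \<in> B" "x \<in> B \<Longrightarrow> y \<in> B \<Longrightarrow> x * y \<in> B"
    "x \<in> B \<Longrightarrow> c *\<^sub>C x \<in> B" "x \<in> B \<Longrightarrow> adj x \<in> B" "closed B"
  using assms unfolding sub_cstar_algebra_def by blast+

lemma sub_cstar_algebra_scaleR: "sub_cstar_algebra B \<Longrightarrow> x \<in> B \<Longrightarrow> r *\<^sub>R x \<in> B"
  by (simp add: scaleR_eq_scaleC sub_cstar_algebraD(4))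

lemma sub_cstar_algebra_uminus: "sub_cstar_algebra B \<Longrightarrow> x \<in> B \<Longrightarrow> - x \<in> B"
  using sub_cstar_algebra_scaleR[of B x "-1"] by simp

lemma sub_cstar_algebra_cstar_generated: "sub_cstar_algebra (cstar_generated S)"
proof -
  have "closed (cstar_generated S)"
    unfolding cstar_generated_def by (rule closed_Inter) (auto dest: sub_cstar_algebraD(6))
  then show ?thesis
    unfolding sub_cstar_algebra_def cstar_generated_def by (auto dest: sub_cstar_algebraD)
qed

lemma cstar_generated_superset: "S \<subseteq> cstar_generated S"
  by (auto simp: cstar_generated_def)

lemma cstar_generated_least: "sub_cstar_algebra B \<Longrightarrow> S \<subseteq> B \<Longrightarrow> cstar_generated S \<subseteq> B"
  by (auto simp: cstar_generated_def)

section \<open>Commutants and normalizers of generated algebras\<close>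

lemma sub_cstar_algebra_relative_commutant:
  fixes S :: "'a::cstar_algebra set"
  assumes "\<And>s. s \<in> S \<Longrightarrow> adj s \<in> S"
  shows "sub_cstar_algebra (relative_commutant S)"
  unfolding sub_cstar_algebra_def
proof (intro conjI ballI allI)
  show "0 \<in> relative_commutant S" by (simp add: relative_commutant_def)
  fix x y :: 'a and c
  assume x: "x \<in> relative_commutant S"
  show "c *\<^sub>C x \<in> relative_commutant S"
    using x by (simp add: relative_commutant_def mult_scaleC_left mult_scaleC_right)
  have "adj x * s = s * adj x" if "s \<in> S" for s
  proof -
    have "adj (x * adj s) = adj (adj s * x)"
      using x assms[OF that] by (simp add: relative_commutant_def)
    then show ?thesis by (simp add: adj_mult adj_adj)
  qed
  then show "adj x \<in> relative_commutant S" by (simp add: relative_commutant_def)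
  assume y: "y \<in> relative_commutant S"
  show "x + y \<in> relative_commutant S"
    using x y by (simp add: relative_commutant_def distrib_left distrib_right)
  have "x * y * s = s * (x * y)" if "s \<in> S" for s
    using x y that by (simp add: relative_commutant_def) (metis mult.assoc)
  then show "x * y \<in> relative_commutant S" by (simp add: relative_commutant_def)
next
  have "closed (\<Inter>s\<in>S. {x. x * s = s * x})"
    by (intro closed_INT ballI closed_Collect_eq continuous_intros)
  also have "(\<Inter>s\<in>S. {x. x * s = s * x}) = relative_commutant S"
    by (auto simp: relative_commutant_def)
  finally show "closed (relative_commutant S)" .
qed

text \<open>Passing to commutants twice: the commutant of \<open>S\<close> is a C*-algebra
  containing \<open>S\<close>, hence contains the generated algebra; so \<open>S\<close> lies in the
  commutant of that algebra, which is again a C*-algebra.\<close>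

lemma cstar_generated_commute:
  assumes adj: "\<And>s. s \<in> S \<Longrightarrow> adj s \<in> S"
    and comm: "\<And>s t. s \<in> S \<Longrightarrow> t \<in> S \<Longrightarrow> s * t = t * s"
    and "x \<in> cstar_generated S" "y \<in> cstar_generated S"
  shows "x * y = y * x"
proof -
  let ?C = "cstar_generated S"
  have "?C \<subseteq> relative_commutant S"
    using comm by (intro cstar_generated_least sub_cstar_algebra_relative_commutant adj)
      (auto simp: relative_commutant_def)
  then have "S \<subseteq> relative_commutant ?C"
    by (force simp: relative_commutant_def)
  then have "?C \<subseteq> relative_commutant ?C"
    by (intro cstar_generated_least sub_cstar_algebra_relative_commutant
      sub_cstar_algebraD(5)[OF sub_cstar_algebra_cstar_generated])
  then show ?thesis using assms(3,4) by (auto simp: relative_commutant_def)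
qed

text \<open>Conjugation by a self-adjoint unitary is a *-automorphism, so the preimage of the
  generated algebra is a C*-algebra, and it suffices to check the generators.\<close>

lemma normalizers_cstar_generatedI:
  fixes n :: "'a::cstar_algebra"
  assumes n: "adj n = n" "n * n = 1"
    and S: "\<And>s. s \<in> S \<Longrightarrow> n * s * n = s \<or> n * s * n = - s"
  shows "n \<in> normalizers (cstar_generated S)"
proof -
  let ?C = "cstar_generated S"
  note C = sub_cstar_algebraD[OF sub_cstar_algebra_cstar_generated]
  have "sub_cstar_algebra {x. n * x * n \<in> ?C}"
    unfolding sub_cstar_algebra_def
  proof (intro conjI ballI allI)
    have "n * (x * y) * n = n * x * n * (n * y * n)" for x y
      using n(2) by (metis mult.assoc mult.right_neutral)
    then show "x * y \<in> {x. n * x * n \<in> ?C}" if "x \<in> {x. n * x * n \<in> ?C}" "y \<in> {x. n * x * n \<in> ?C}" for x y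
      using that C(3) by simp
    have "n * adj x * n = adj (n * x * n)" for x
      by (simp add: adj_mult n(1) mult.assoc)
    then show "adj x \<in> {x. n * x * n \<in> ?C}" if "x \<in> {x. n * x * n \<in> ?C}" for x
      using that C(5) by simp
    have "closed ((\<lambda>x. n * x * n) -` ?C)"
      by (intro closed_vimage C(6) continuous_intros)
    then show "closed {x. n * x * n \<in> ?C}" by (simp add: vimage_def)
  qed (use C in \<open>auto simp: distrib_left distrib_right mult_scaleC_left mult_scaleC_right\<close>)
  moreover have "S \<subseteq> {x. n * x * n \<in> ?C}"
    using S cstar_generated_superset[of S]
    by (force intro: sub_cstar_algebra_uminus[OF sub_cstar_algebra_cstar_generated])
  ultimately have "?C \<subseteq> {x. n * x * n \<in> ?C}" by (rule cstar_generated_least)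
  then show ?thesis by (auto simp: normalizers_def n(1))
qed

section \<open>Averaging over commuting symmetries\<close>

text \<open>If \<open>g * g = 1\<close>, this is the projection onto the commutant of
  \<open>g\<close>.\<close>

definition avg :: "'a::real_normed_algebra_1 \<Rightarrow> 'a \<Rightarrow> 'a"
  where "avg g x = (1 / 2) *\<^sub>R (x + g * x * g)"

lemma linear_avg: "linear (avg g)"
  by (rule linearI) (simp_all add: avg_def algebra_simps)

lemma linear_foldr_avg: "linear (foldr avg gs)"
proof (induction gs)
  case Nil
  show ?case by (simp add: id_def linear_ident)
next
  case (Cons g gs)
  then show ?case using linear_compose[OF _ linear_avg, of "foldr avg gs"] by (simp add: o_def)
qed

text \<open>Conjugating by commuting elements gives the same result in either order, so both
  iterated averages expand to a quarter of the same four terms.\<close>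

lemma avg_commute:
  assumes "g * h = h * g"
  shows "avg g (avg h x) = avg h (avg g x)"
proof -
  have "g * (h * x * h) * g = g * h * x * (h * g)" by (simp only: mult.assoc)
  also have "\<dots> = h * g * x * (g * h)" by (simp only: assms)
  also have "\<dots> = h * (g * x * g) * h" by (simp only: mult.assoc)
  finally have *: "g * (h * x * h) * g = h * (g * x * g) * h" .
  have "avg k (avg l x) = (1 / 4) *\<^sub>R (x + l * x * l + k * x * k + k * (l * x * l) * k)" for k l
    by (simp add: avg_def distrib_left distrib_right scaleR_add_right add.assoc)
  then show ?thesis by (simp only: * add.commute add.left_commute)
qed

lemma foldr_avg_commute:
  "(\<And>h. h \<in> set gs \<Longrightarrow> g * h = h * g) \<Longrightarrow> avg g (foldr avg gs x) = foldr avg gs (avg g x)"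
  by (induction gs) (simp_all add: avg_commute)

text \<open>Allows a list of generators chosen for one element to be applied before or after a list
  chosen for another.\<close>

lemma foldr_avg_swap:
  assumes "\<And>g h. g \<in> set gs \<Longrightarrow> h \<in> set hs \<Longrightarrow> g * h = h * g"
  shows "foldr avg gs (foldr avg hs x) = foldr avg hs (foldr avg gs x)"
  using assms
proof (induction gs)
  case (Cons g gs)
  have "foldr avg gs (foldr avg hs x) = foldr avg hs (foldr avg gs x)"
  proof (rule Cons.IH)
    show "k * h = h * k" if "k \<in> set gs" "h \<in> set hs" for k h
      using list.set_intros(2)[OF that(1)] that(2) by (rule Cons.prems)
  qed
  moreover have "avg g (foldr avg hs (foldr avg gs x)) = foldr avg hs (avg g (foldr avg gs x))"
  proof (rule foldr_avg_commute)
    show "g * h = h * g" if "h \<in> set hs" for h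
      using list.set_intros(1) that by (rule Cons.prems)
  qed
  ultimately show ?case by simp
qed simp

lemma norm_avg_le:
  assumes "norm g \<le> 1"
  shows "norm (avg g x) \<le> norm x"
proof -
  have "norm (g * x * g) \<le> norm g * norm x * norm g"
    by (intro order_trans[OF norm_mult_ineq] mult_right_mono norm_mult_ineq norm_ge_zero)
  also have "\<dots> \<le> 1 * norm x * 1"
    using assms by (intro mult_mono) auto
  finally have "norm (x + g * x * g) \<le> norm x + norm x"
    by (intro norm_triangle_le) simp
  then show ?thesis by (simp add: avg_def)
qed

lemma norm_foldr_avg_le:
  "(\<And>g. g \<in> set gs \<Longrightarrow> norm g \<le> 1) \<Longrightarrow> norm (foldr avg gs x) \<le> norm x"
  by (induction gs) (auto intro: order_trans[OF norm_avg_le])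

lemma foldr_avg_fixed:
  assumes "\<And>g. g \<in> set gs \<Longrightarrow> g * g = 1 \<and> x * g = g * x"
  shows "foldr avg gs x = x"
  using assms
proof (induction gs)
  case (Cons g gs)
  have "g * g = 1" "x * g = g * x" using Cons.prems[of g] by auto
  then have "g * x * g = x" by (simp only: mult.assoc flip: mult.assoc[of g g]) simp
  moreover have "(1 / 2 :: real) *\<^sub>R (x + x) = x" by (simp flip: scaleR_2)
  ultimately show ?case using Cons by (simp add: avg_def)
qed simp

lemma foldr_avg_mem:
  "sub_cstar_algebra B \<Longrightarrow> set gs \<subseteq> B \<Longrightarrow> x \<in> B \<Longrightarrow> foldr avg gs x \<in> B"
  by (induction gs) (auto simp: avg_def intro!: sub_cstar_algebra_scaleR sub_cstar_algebraD(2,3))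

text \<open>Averaging fixes the commutant of \<open>G\<close> and kills every element of \<open>W\<close> outside the algebra
  generated by \<open>G\<close>, so it sends approximations of an element of the commutant from the span of \<open>W\<close> to
  approximations from that algebra.\<close>

lemma masa_cstar_generatedI:
  fixes G W :: "'a::cstar_algebra set"
  assumes G: "\<And>g. g \<in> G \<Longrightarrow> adj g = g \<and> g * g = 1"
    and comm: "\<And>g h. g \<in> G \<Longrightarrow> h \<in> G \<Longrightarrow> g * h = h * g"
    and dense: "closure (span W) = UNIV"
    and W: "\<And>w. w \<in> W \<Longrightarrow> w \<in> cstar_generated G \<or> (\<exists>g\<in>G. g * w * g = - w)"
  shows "masa (cstar_generated G)"
proof -
  let ?C = "cstar_generated G"
  note C = sub_cstar_algebra_cstar_generated[of G]
  have abelian: "x * y = y * x" if "x \<in> ?C" "y \<in> ?C" for x y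
    using cstar_generated_commute[OF _ comm that] G by auto
  \<comment> \<open>The C*-identity applied to a self-adjoint square root of 1.\<close>
  have norm: "norm g \<le> 1" if "g \<in> G" for g
  proof -
    have "norm (adj g * g) = 1" using G[OF that] by simp
    then have "(norm g)\<^sup>2 = 1\<^sup>2" by (simp only: norm_adj_mult_self power_one)
    then have "norm g = 1" by (rule power2_eq_imp_eq) auto
    then show ?thesis by simp
  qed
  \<comment> \<open>Different words need different generators to be killed, so the list may depend
    on the element; finitely many averages suffice for each element of the span.\<close>
  define D where "D = {a. \<exists>gs. set gs \<subseteq> G \<and> foldr avg gs a \<in> ?C}"
  have "subspace D"
  proof (rule subspaceI)
    show "0 \<in> D"
      unfolding D_def using sub_cstar_algebraD(1)[OF C] by (auto intro!: exI[of _ "[]"])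
    show "c *\<^sub>R a \<in> D" if "a \<in> D" for c a
      using that unfolding D_def
      by (auto simp: linear_scale[OF linear_foldr_avg] intro: sub_cstar_algebra_scaleR[OF C])
    fix a b assume "a \<in> D" "b \<in> D"
    then obtain gs hs where gs: "set gs \<subseteq> G" "foldr avg gs a \<in> ?C"
      and hs: "set hs \<subseteq> G" "foldr avg hs b \<in> ?C"
      by (auto simp: D_def)
    have mem: "set ks \<subseteq> G \<Longrightarrow> x \<in> ?C \<Longrightarrow> foldr avg ks x \<in> ?C" for ks x
      using foldr_avg_mem[OF C] cstar_generated_superset[of G] by blast
    \<comment> \<open>Each summand is first averaged by its own list, which takes it into the
      algebra; the other list then keeps it there.\<close>
    have "foldr avg (gs @ hs) (a + b) = foldr avg hs (foldr avg gs a) + foldr avg gs (foldr avg hs b)"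
      using foldr_avg_swap[of gs hs a] gs(1) hs(1) comm
      by (auto simp: linear_add[OF linear_foldr_avg])
    also have "\<dots> \<in> ?C"
      by (intro sub_cstar_algebraD(2)[OF C] mem gs hs)
    finally show "a + b \<in> D" unfolding D_def using gs(1) hs(1) by (auto intro!: exI[of _ "gs @ hs"])
  qed
  moreover have "W \<subseteq> D"
  proof
    fix w assume "w \<in> W"
    then consider "w \<in> ?C" | g where "g \<in> G" "g * w * g = - w" using W by blast
    then show "w \<in> D"
    proof cases
      case 1
      then show ?thesis unfolding D_def by (auto intro!: exI[of _ "[]"])
    next
      case 2
      then show ?thesis unfolding D_def
        using sub_cstar_algebraD(1)[OF C] by (auto simp: avg_def intro!: exI[of _ "[g]"])
    qed
  qed
  ultimately have D: "span W \<subseteq> D" by (rule span_minimal[rotated])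
  have "x \<in> ?C" if x: "x \<in> relative_commutant ?C" for x
  proof -
    have "\<exists>y\<in>?C. dist y x < e" if "e > 0" for e
    proof -
      have "x \<in> closure (span W)" by (simp add: dense)
      then obtain a where a: "a \<in> span W" "dist a x < e"
        using \<open>e > 0\<close> unfolding closure_approachable by blast
      then obtain gs where gs: "set gs \<subseteq> G" "foldr avg gs a \<in> ?C" using D by (auto simp: D_def)
      have "foldr avg gs x = x"
        using gs(1) G x cstar_generated_superset[of G] unfolding relative_commutant_def
        by (intro foldr_avg_fixed) blast
      then have "dist (foldr avg gs a) x = norm (foldr avg gs (a - x))"
        by (simp add: dist_norm linear_diff[OF linear_foldr_avg])
      also have "\<dots> \<le> norm (a - x)" using gs(1) norm by (intro norm_foldr_avg_le) auto
      also have "\<dots> < e" using a(2) by (simp add: dist_norm)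
      finally show ?thesis using gs(2) by blast
    qed
    then show ?thesis
      using closure_approachable[of x ?C] sub_cstar_algebraD(6)[OF C] by simp
  qed
  then have "relative_commutant ?C = ?C"
    using abelian unfolding relative_commutant_def by blast
  then show ?thesis using C abelian unfolding masa_def by blast
qed

section \<open>Products of commuting symmetries\<close>

lemma comm_prod_empty: "comm_prod f {} = 1"
  by (simp add: comm_prod_def)

text \<open>Parity of the intersection with \<open>A\<close> is additive modulo 2, because elements
  of \<open>S\<close>, \<open>T\<close> and \<open>A\<close> at once are counted twice.\<close>

lemma even_card_sym_diff:
  assumes "finite S" "finite T"
  shows "even (card (sym_diff S T \<inter> A)) \<longleftrightarrow> (even (card (S \<inter> A)) \<longleftrightarrow> even (card (T \<inter> A)))"
proof -
  have "card (S \<inter> A) = card ((S - T) \<inter> A) + card (S \<inter> T \<inter> A)"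
    using assms by (subst card_Un_disjoint[symmetric]) (auto intro: arg_cong[where f = card])
  moreover have "card (T \<inter> A) = card ((T - S) \<inter> A) + card (S \<inter> T \<inter> A)"
    using assms by (subst card_Un_disjoint[symmetric]) (auto intro: arg_cong[where f = card])
  moreover have "card (sym_diff S T \<inter> A) = card ((S - T) \<inter> A) + card ((T - S) \<inter> A)"
    using assms by (subst card_Un_disjoint[symmetric]) (auto intro: arg_cong[where f = card])
  ultimately show ?thesis by auto
qed

context
  fixes f :: "'i \<Rightarrow> 'a::monoid_mult"
  assumes comm: "\<And>i j. f i * f j = f j * f i" and sq: "\<And>i. f i * f i = 1"
begin

lemma comm_prod_single: "comm_prod f {i} = f i"
  using comm_prod_insert[OF comm, of "{}" i] by (simp add: comm_prod_empty)

lemma comm_prod_times_single: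
  assumes "finite S"
  shows "f i * comm_prod f S = comm_prod f (sym_diff S {i})"
proof (cases "i \<in> S")
  case True
  have "comm_prod f (insert i (S - {i})) = f i * comm_prod f (S - {i})"
    using assms by (intro comm_prod_insert comm) auto
  then have "f i * comm_prod f S = f i * f i * comm_prod f (S - {i})"
    using True by (simp add: insert_absorb mult.assoc)
  moreover have "sym_diff S {i} = S - {i}" using True by auto
  ultimately show ?thesis by (simp add: sq)
next
  case False
  then have "sym_diff S {i} = insert i S" by auto
  then show ?thesis using False assms by (simp add: comm_prod_insert comm)
qed

text \<open>Common factors cancel in pairs, so finite sets under symmetric difference are
  represented multiplicatively. This links the algebra to mod 2 chains of edges.\<close>

lemma comm_prod_mult:
  assumes "finite S" "finite T"
  shows "comm_prod f S * comm_prod f T = comm_prod f (sym_diff S T)"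
  using assms(1)
proof (induction S rule: finite_induct)
  case empty
  then show ?case by (simp add: comm_prod_empty)
next
  case (insert i S)
  have "comm_prod f (insert i S) * comm_prod f T = f i * (comm_prod f S * comm_prod f T)"
    using insert.hyps by (simp add: comm_prod_insert comm mult.assoc)
  also have "\<dots> = comm_prod f (sym_diff (sym_diff S T) {i})"
    using insert assms(2) by (simp add: comm_prod_times_single)
  also have "sym_diff (sym_diff S T) {i} = sym_diff (insert i S) T"
    using insert.hyps by auto
  finally show ?case .
qed

lemma comm_prod_commute: "finite S \<Longrightarrow> finite T \<Longrightarrow> comm_prod f S * comm_prod f T = comm_prod f T * comm_prod f S"
  by (simp add: comm_prod_mult Un_commute)

lemma comm_prod_sq: "finite S \<Longrightarrow> comm_prod f S * comm_prod f S = 1"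
  by (simp add: comm_prod_mult comm_prod_empty)

end

lemma adj_one: "adj 1 = (1 :: 'a::pre_cstar_algebra)"
  by (metis adj_adj adj_mult mult.left_neutral mult.right_neutral)

text \<open>The involution reverses the factors, and commutativity restores their order.\<close>

lemma adj_comm_prod:
  fixes f :: "'i \<Rightarrow> 'a::pre_cstar_algebra"
  assumes comm: "\<And>i j. f i * f j = f j * f i" and sq: "\<And>i. f i * f i = 1"
    and adj: "\<And>i. adj (f i) = f i" and "finite S"
  shows "adj (comm_prod f S) = comm_prod f S"
  using assms(4)
proof (induction S rule: finite_induct)
  case empty
  then show ?case by (simp add: comm_prod_empty adj_one)
next
  case (insert i S)
  then show ?case
    using comm_prod_commute[of f, OF comm sq, of S "{i}"]
    by (simp add: comm_prod_insert comm adj_mult adj comm_prod_single[of f, OF comm sq])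
qed

text \<open>Moving one product through the other costs one sign for every common index.\<close>

lemma comm_prod_anticommute:
  fixes f g :: "'i \<Rightarrow> 'a::ring_1"
  assumes f: "\<And>i j. f i * f j = f j * f i" and g: "\<And>i j. g i * g j = g j * g i"
    and fg: "\<And>i j. g j * f i = (if i = j then - (f i * g j) else f i * g j)"
    and "finite S" "finite T"
  shows "comm_prod g T * comm_prod f S =
    (if even (card (S \<inter> T)) then comm_prod f S * comm_prod g T else - (comm_prod f S * comm_prod g T))"
proof -
  have single: "g j * comm_prod f S = (if j \<in> S then - (comm_prod f S * g j) else comm_prod f S * g j)" for j
    using assms(4)
  proof (induction S rule: finite_induct)
    case empty
    then show ?case by (simp add: comm_prod_empty)
  next
    case (insert i S)
    have "g j * comm_prod f (insert i S) = g j * f i * comm_prod f S"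
      using insert.hyps by (simp add: comm_prod_insert f mult.assoc)
    also have "\<dots> = (if i = j then - (f i * (g j * comm_prod f S)) else f i * (g j * comm_prod f S))"
      by (simp add: fg mult.assoc)
    finally show ?case
      using insert by (auto simp: comm_prod_insert f mult.assoc)
  qed
  show ?thesis
    using assms(5)
  proof (induction T rule: finite_induct)
    case empty
    then show ?case by (simp add: comm_prod_empty)
  next
    case (insert j T)
    have "comm_prod g (insert j T) * comm_prod f S = g j * (comm_prod g T * comm_prod f S)"
      using insert.hyps by (simp add: comm_prod_insert g mult.assoc)
    also have "\<dots> = (if even (card (S \<inter> T)) then g j * comm_prod f S * comm_prod g T
        else - (g j * comm_prod f S * comm_prod g T))"
      by (simp add: insert.IH mult.assoc)
    finally show ?case
      using insert.hyps assms(4) by (simp add: single comm_prod_insert g mult.assoc)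
  qed
qed

section \<open>The local algebras are generated by the Pauli matrices\<close>

text \<open>The configurations agreeing with \<open>s\<close> off \<open>e\<close> are exactly the
  updates of \<open>s\<close> at \<open>e\<close>.\<close>

lemma sum_eq_off_single: "(\<Sum>t | eq_off {e} s t. f t) = (\<Sum>k\<in>UNIV. f (s(e := k)))"
proof -
  have "{t. eq_off {e} s t} = range (\<lambda>k. s(e := k))"
    by (auto simp: eq_off_def fun_eq_iff image_iff)
  moreover have "inj (\<lambda>k. s(e := k))"
    by (auto simp: inj_def dest: fun_cong[where x = e])
  ultimately show ?thesis by (simp add: sum.reindex)
qed

lemma entries_site_op: "entries (site_op e m) s t = (if eq_off {e} s t then m $ s e $ t e else 0)"
  by transfer simp

lemma entries_site_op_times:
  "entries (site_op e m * a) s u = (\<Sum>k\<in>UNIV. m $ s e $ k * entries a (s(e := k)) u)"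
proof -
  have "entries (site_op e m) \<in> local_mats {e}"
    by (rule local_matsI[where M="\<lambda>p q. m $ p e $ q e"]) (simp add: entries_site_op)
  then have "entries (site_op e m * a) s u =
      (\<Sum>t | eq_off {e} s t. entries (site_op e m) s t * entries a t u)"
    unfolding times_local_alg.rep_eq by (intro mat_mult_local) auto
  also have "\<dots> = (\<Sum>t | eq_off {e} s t. m $ s e $ t e * entries a t u)"
    by (intro sum.cong) (auto simp: entries_site_op)
  finally show ?thesis by (simp add: sum_eq_off_single)
qed

lemma local_alg_eqI: "(\<And>s t. entries a s t = entries b s t) \<Longrightarrow> a = b"
  by (metis entries_inject ext)

lemma sigma_entries [simp]:
  "sigma_x $ 1 $ 1 = 0" "sigma_x $ 1 $ 2 = 1" "sigma_x $ 2 $ 1 = 1" "sigma_x $ 2 $ 2 = 0"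
  "sigma_z $ 1 $ 1 = 1" "sigma_z $ 1 $ 2 = 0" "sigma_z $ 2 $ 1 = 0" "sigma_z $ 2 $ 2 = -1"
  by (simp_all add: sigma_x_def sigma_z_def)

lemma entries_uminus: "entries (- a) s t = - entries a s t"
  by (simp add: uminus_local_alg_def scaleC_local_alg.rep_eq)

lemmas entries_simps = entries_site_op_times entries_site_op one_local_alg.rep_eq
  plus_local_alg.rep_eq scaleC_local_alg.rep_eq adj_local_alg.rep_eq entries_uminus

lemma eq_off_upd: "eq_off {e} (s(e := k)) t \<longleftrightarrow> eq_off {e} s t"
  by (auto simp: eq_off_def)

text \<open>Puts the entries of the identity into the same shape as those of a site operator at
  \<open>e\<close>, so that the two can be compared.\<close>

lemma config_eq_iff: "s = t \<longleftrightarrow> eq_off {e} s t \<and> s e = t e"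
  by (auto simp: eq_off_def)

lemma site_op_sigma_sq:
  "site_op e sigma_x * site_op e sigma_x = 1" "site_op e sigma_z * site_op e sigma_z = 1"
proof -
  have "entries (site_op e m * site_op e m) s t = entries 1 s t"
    if "m = sigma_x \<or> m = sigma_z" for m s t
    using that exhaust_2[of "s e"] exhaust_2[of "t e"]
    by (elim disjE) (simp_all add: entries_simps sum_2 eq_off_upd config_eq_iff[of s t e])
  then show "site_op e sigma_x * site_op e sigma_x = 1" "site_op e sigma_z * site_op e sigma_z = 1"
    by (auto intro: local_alg_eqI)
qed

lemma site_op_sigma_anticommute:
  "site_op e sigma_z * site_op e sigma_x = - (site_op e sigma_x * site_op e sigma_z)"
proof (rule local_alg_eqI)
  fix s t
  show "entries (site_op e sigma_z * site_op e sigma_x) s t =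
      entries (- (site_op e sigma_x * site_op e sigma_z)) s t"
    using exhaust_2[of "s e"] exhaust_2[of "t e"]
    by (elim disjE) (simp_all add: entries_simps sum_2 eq_off_upd)
qed

lemma adj_site_op_sigma:
  "adj (site_op e sigma_x) = site_op e sigma_x" "adj (site_op e sigma_z) = site_op e sigma_z"
proof -
  have "entries (adj (site_op e m)) s t = entries (site_op e m) s t"
    if "m = sigma_x \<or> m = sigma_z" for m s t
    using that exhaust_2[of "s e"] exhaust_2[of "t e"]
    by (elim disjE) (simp_all add: entries_simps eq_off_sym[of _ t])
  then show "adj (site_op e sigma_x) = site_op e sigma_x" "adj (site_op e sigma_z) = site_op e sigma_z"
    by (auto intro: local_alg_eqI)
qed

text \<open>The matrices 1, \<open>sigma_z\<close>, \<open>sigma_x\<close> and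
  \<open>sigma_z\<close> times \<open>sigma_x\<close> form a basis of the 2-by-2 matrices; the
  coefficients are those of \<open>m\<close> in it.\<close>

lemma site_op_times_decompose:
  "site_op e m * a =
    ((m $ 1 $ 1 + m $ 2 $ 2) / 2) *\<^sub>C a + ((m $ 1 $ 1 - m $ 2 $ 2) / 2) *\<^sub>C (site_op e sigma_z * a) +
    (((m $ 1 $ 2 + m $ 2 $ 1) / 2) *\<^sub>C (site_op e sigma_x * a) +
     ((m $ 1 $ 2 - m $ 2 $ 1) / 2) *\<^sub>C (site_op e sigma_z * (site_op e sigma_x * a)))"
proof (rule local_alg_eqI)
  fix s t
  \<comment> \<open>Exposes the value at \<open>e\<close> in the term without a site operator, to
    match the updated configurations in the other terms.\<close>
  have "entries a s t = entries a (s(e := s e)) t" by simp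
  then show "entries (site_op e m * a) s t = entries (((m $ 1 $ 1 + m $ 2 $ 2) / 2) *\<^sub>C a + ((m $ 1 $ 1 - m $ 2 $ 2) / 2) *\<^sub>C (site_op e sigma_z * a) +
    (((m $ 1 $ 2 + m $ 2 $ 1) / 2) *\<^sub>C (site_op e sigma_x * a) +
     ((m $ 1 $ 2 - m $ 2 $ 1) / 2) *\<^sub>C (site_op e sigma_z * (site_op e sigma_x * a)))) s t"
    using exhaust_2[of "s e"]
    by (auto simp: entries_simps sum_2 field_simps simp del: fun_upd_triv)
qed

text \<open>Sites are split off one at a time: an element is a sum of matrix units at the site times
  elements supported on the remaining sites, and matrix units are combinations of Pauli
  products.\<close>

lemma local_alg_induct [case_names one add scaleC sigma_x sigma_z]:
  fixes a :: "'e local_alg"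
  assumes one: "P 1"
    and add: "\<And>a b. P a \<Longrightarrow> P b \<Longrightarrow> P (a + b)"
    and scaleC: "\<And>c a. P a \<Longrightarrow> P (c *\<^sub>C a)"
    and sigma_x: "\<And>e a. P a \<Longrightarrow> P (site_op e sigma_x * a)"
    and sigma_z: "\<And>e a. P a \<Longrightarrow> P (site_op e sigma_z * a)"
  shows "P a"
proof -
  have "P a" if "finite \<Lambda>" "entries a \<in> local_mats \<Lambda>" for \<Lambda> a
    using that
  proof (induction \<Lambda> arbitrary: a rule: finite_induct)
    case empty
    then obtain M where M: "\<And>s t. entries a s t =
        (if eq_off {} s t then M (restrict s {}) (restrict t {}) else 0)"
      by (rule local_matsE) blast
    \<comment> \<open>Without sites only scalars remain; every configuration restricts to the
      constant \<open>undefined\<close>.\<close>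
    have "a = M (\<lambda>_. undefined) (\<lambda>_. undefined) *\<^sub>C 1"
      by (rule local_alg_eqI) (auto simp: entries_simps M restrict_def eq_off_def)
    then show ?case using one scaleC by metis
  next
    case (insert e \<Lambda>)
    obtain M where M: "\<And>s t. entries a s t = (if eq_off (insert e \<Lambda>) s t
        then M (restrict s (insert e \<Lambda>)) (restrict t (insert e \<Lambda>)) else 0)"
      using insert.prems by (rule local_matsE) blast
    \<comment> \<open>The block of \<open>a\<close> with row index \<open>i\<close> and column index
      \<open>j\<close> at the site \<open>e\<close>, extended by the identity at
      \<open>e\<close>.\<close>
    define B where "B i j s t = (if eq_off \<Lambda> s t then entries a (s(e := i)) (t(e := j)) else 0)" for i j s t
    have R: "restrict (s(e := i)) (insert e \<Lambda>) = (restrict s \<Lambda>)(e := i)" for s :: "'e \<Rightarrow> 2" and i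
      by (auto simp: restrict_def)
    have O: "eq_off (insert e \<Lambda>) (s(e := i)) (t(e := j))" if "eq_off \<Lambda> s t" for s t :: "'e \<Rightarrow> 2" and i j
      using that by (auto simp: eq_off_def)
    have B: "B i j \<in> local_mats \<Lambda>" for i j
      by (rule local_matsI[where M="\<lambda>p q. M (p(e := i)) (q(e := j))"]) (auto simp: B_def M R O)
    define b where "b i j = Abs_local_alg (B i j)" for i j
    have eb: "entries (b i j) = B i j" for i j
      unfolding b_def using B insert.hyps by (intro Abs_local_alg_inverse) auto
    have Pb: "P (b i j)" for i j
      by (rule insert.IH) (simp add: eb B)
    have Ps: "P (site_op e m * x)" if "P x" for m x
      by (subst site_op_times_decompose) (intro add scaleC sigma_x sigma_z that)
    \<comment> \<open>The matrix units of the site.\<close>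
    define u :: "2 \<Rightarrow> 2 \<Rightarrow> complex^2^2" where "u i j = (\<chi> k l. if k = i \<and> l = j then 1 else 0)" for i j
    have U: "entries (site_op e (u i j) * b i j) s t = (if s e = i \<and> t e = j then entries a s t else 0)"
      for i j s t
    proof -
      have "entries (site_op e (u i j) * b i j) s t = (\<Sum>k\<in>UNIV. if k = j then (if s e = i then B i j (s(e := j)) t else 0) else 0)"
        unfolding entries_site_op_times eb by (rule sum.cong) (auto simp: u_def)
      moreover have "B i j (s(e := j)) t = (if t e = j then entries a s t else 0)" if "s e = i"
      proof -
        have "eq_off \<Lambda> (s(e := j)) t \<longleftrightarrow> eq_off (insert e \<Lambda>) s t \<and> t e = j"
          using insert.hyps by (auto simp: eq_off_def)
        then show ?thesis using that by (auto simp: B_def M)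
      qed
      ultimately show ?thesis by simp
    qed
    have "a = site_op e (u 1 1) * b 1 1 + site_op e (u 1 2) * b 1 2 +
        (site_op e (u 2 1) * b 2 1 + site_op e (u 2 2) * b 2 2)"
    proof (rule local_alg_eqI)
      fix s t
      show "entries a s t = entries (site_op e (u 1 1) * b 1 1 + site_op e (u 1 2) * b 1 2 +
        (site_op e (u 2 1) * b 2 1 + site_op e (u 2 2) * b 2 2)) s t"
        using exhaust_2[of "s e"] exhaust_2[of "t e"]
        by (elim disjE) (simp_all add: plus_local_alg.rep_eq U)
    qed
    then show ?case using Pb Ps add by metis
  qed
  then show ?thesis using entries[of a] by blast
qed

section \<open>Even sets of edges\<close>

text \<open>Horizontal and vertical edges are kept abstract so that one combinatorial argument
  serves both the lattice and its dual, where stars and faces exchange roles.\<close>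

locale square_grid =
  fixes H V :: "int \<Rightarrow> int \<Rightarrow> 'e"
  assumes H_eq_iff [simp]: "H i j = H k l \<longleftrightarrow> i = k \<and> j = l"
    and V_eq_iff [simp]: "V i j = V k l \<longleftrightarrow> i = k \<and> j = l"
    and H_neq_V [simp]: "H i j \<noteq> V k l"
    and edge_exhaust: "(\<exists>i j. e = H i j) \<or> (\<exists>i j. e = V i j)"
begin

lemma V_neq_H [simp]: "V k l \<noteq> H i j"
  using H_neq_V by metis

text \<open>The edges at the vertex \<open>(i, j)\<close>, where \<open>H i j\<close> is read as
  leading from it to the right and \<open>V i j\<close> as leading upwards.\<close>

definition cross :: "int \<Rightarrow> int \<Rightarrow> 'e set"
  where "cross i j = {H i j, V i j, H (i - 1) j, V i (j - 1)}"

definition square :: "int \<Rightarrow> int \<Rightarrow> 'e set"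
  where "square i j = {H i j, V i j, H i (j + 1), V (i + 1) j}"

lemma finite_square: "finite (square i j)"
  by (simp add: square_def)

text \<open>A vertex at one of the four corners of a square meets exactly two of its sides; any
  other vertex meets none.\<close>

lemma even_card_square_cross: "even (card (square k l \<inter> cross i j))"
proof -
  consider "k = i" "l = j" | "k = i - 1" "l = j" | "k = i" "l = j - 1" | "k = i - 1" "l = j - 1"
    | "k \<noteq> i \<and> k \<noteq> i - 1 \<or> l \<noteq> j \<and> l \<noteq> j - 1"
    by blast
  then show ?thesis
  proof cases
    case 5
    then have "square k l \<inter> cross i j = {}" by (auto simp: square_def cross_def)
    then show ?thesis by simp
  qed (simp_all add: square_def cross_def Int_insert_left)
qed

text \<open>The vertices of the box \<open>{a ..< a + M}\<^sup>2\<close> are ordered lexicographically by the rank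
  \<open>(x - a) * M + (y - a)\<close>. At the last vertex touched by an even set exactly the edges to the left and
  below are present; adding the square at the lower left trades them for edges of smaller rank.\<close>

lemma even_induct [consumes 2, case_names empty square]:
  assumes "finite T" and "\<And>i j. even (card (T \<inter> cross i j))"
    and empty: "P {}"
    and square: "\<And>T i j. finite T \<Longrightarrow> P T \<Longrightarrow> P (sym_diff T (square i j))"
  shows "P T"
proof -
  \<comment> \<open>The rank of an edge is taken at its right or upper endpoint. All such ranks lie
    below \<open>n\<close>, and the second coordinates stay in a strip of height
    \<open>M\<close>.\<close>
  define bnd where "bnd a M n T \<longleftrightarrow>
      (\<forall>i j. H i j \<in> T \<longrightarrow> a \<le> i \<and> a \<le> j \<and> j < a + M \<and> (i + 1 - a) * M + (j - a) < n) \<and>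
      (\<forall>i j. V i j \<in> T \<longrightarrow> a \<le> i \<and> a \<le> j \<and> j + 1 < a + M \<and> (i - a) * M + (j + 1 - a) < n)"
    for a M n and T :: "'e set"
  have main: "P T" if "finite T" "\<And>i j. even (card (T \<inter> cross i j))" "bnd a M (int n) T" "M > 0" for T a M n
    using that
  proof (induction n arbitrary: T)
    case 0
    have "H i j \<notin> T" for i j
    proof
      assume "H i j \<in> T"
      then have "a \<le> i" "a \<le> j" "(i + 1 - a) * M + (j - a) < 0" using 0 by (auto simp: bnd_def)
      moreover have "(i + 1 - a) * M \<ge> 0" using \<open>a \<le> i\<close> \<open>M > 0\<close> by simp
      ultimately show False by linarith
    qed
    moreover have "V i j \<notin> T" for i j
    proof
      assume "V i j \<in> T"
      then have "a \<le> i" "a \<le> j" "(i - a) * M + (j + 1 - a) < 0" using 0 by (auto simp: bnd_def)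
      moreover have "(i - a) * M \<ge> 0" using \<open>a \<le> i\<close> \<open>M > 0\<close> by simp
      ultimately show False by linarith
    qed
    ultimately have "T = {}" using edge_exhaust by (metis all_not_in_conv)
    then show ?case using empty by simp
  next
    case (Suc n)
    \<comment> \<open>The vertex of rank \<open>n\<close>.\<close>
    define x y where "x = a + int n div M" and "y = a + int n mod M"
    have y: "a \<le> y" "y < a + M" using \<open>M > 0\<close> by (simp_all add: y_def)
    have n: "int n = (x - a) * M + (y - a)" by (simp add: x_def y_def)
    \<comment> \<open>Uniqueness of quotient and remainder modulo \<open>M\<close>; it relies on
      \<open>q\<close> lying in the strip.\<close>
    have rank: "p = x \<and> q = y" if "(p - a) * M + (q - a) = int n" "a \<le> q" "q < a + M" for p q
    proof -
      have "int n div M = p - a" "int n mod M = q - a"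
        unfolding that(1)[symmetric] using that(2,3) \<open>M > 0\<close> by simp_all
      then show ?thesis by (simp add: x_def y_def)
    qed
    have TH: "a \<le> i \<and> a \<le> j \<and> j < a + M \<and> (i + 1 - a) * M + (j - a) \<le> int n" if "H i j \<in> T" for i j
      using Suc.prems(3) that by (force simp: bnd_def)
    have TV: "a \<le> i \<and> a \<le> j \<and> j + 1 < a + M \<and> (i - a) * M + (j + 1 - a) \<le> int n" if "V i j \<in> T" for i j
      using Suc.prems(3) that by (force simp: bnd_def)
    \<comment> \<open>These two edges would end at vertices of rank \<open>n + M\<close> and
      \<open>n + 1\<close>.\<close>
    have "H x y \<notin> T" using TH[of x y] \<open>M > 0\<close> n by (auto simp: algebra_simps)
    moreover have "V x y \<notin> T" using TV[of x y] n by (auto simp: algebra_simps)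
    ultimately have "T \<inter> cross x y = T \<inter> {H (x - 1) y, V x (y - 1)}" by (auto simp: cross_def)
    with Suc.prems(2)[of x y] have even: "even (card (T \<inter> {H (x - 1) y, V x (y - 1)}))" by simp
    show ?case
    proof (cases "H (x - 1) y \<in> T")
      case False
      \<comment> \<open>By parity the two remaining edges are absent together, so no edge ends at
        rank \<open>n\<close> and the bound already holds with \<open>n\<close>.\<close>
      then have F: "H (x - 1) y \<notin> T" "V x (y - 1) \<notin> T" using even by (auto simp: Int_insert_right)
      have "bnd a M (int n) T"
        unfolding bnd_def
      proof (intro conjI allI impI)
        fix i j assume e: "H i j \<in> T"
        show "a \<le> i" "a \<le> j" "j < a + M" using TH[OF e] by auto
        have "(i + 1 - a) * M + (j - a) \<noteq> int n"
          using rank[of "i + 1" j] TH[OF e] F e by auto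
        then show "(i + 1 - a) * M + (j - a) < int n" using TH[OF e] by simp
      next
        fix i j assume e: "V i j \<in> T"
        show "a \<le> i" "a \<le> j" "j + 1 < a + M" using TV[OF e] by auto
        have "(i - a) * M + (j + 1 - a) \<noteq> int n"
          using rank[of i "j + 1"] TV[OF e] F e by auto
        then show "(i - a) * M + (j + 1 - a) < int n" using TV[OF e] by simp
      qed
      then show ?thesis using Suc by blast
    next
      case True
      then have F: "H (x - 1) y \<in> T" "V x (y - 1) \<in> T" using even by (auto simp: Int_insert_right split: if_splits)
      \<comment> \<open>The square with upper right corner \<open>(x, y)\<close>. Adding it removes
        both edges ending there and toggles two edges ending at ranks \<open>n - 1\<close> and
        \<open>n - M\<close>.\<close>
      define Q where "Q = square (x - 1) (y - 1)"
      have Q: "Q = {H (x - 1) (y - 1), V (x - 1) (y - 1), H (x - 1) y, V x (y - 1)}"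
        by (simp add: Q_def square_def)
      let ?T = "sym_diff T Q"
      have HT: "H i j \<in> ?T \<Longrightarrow> H i j \<in> T \<and> (i, j) \<noteq> (x - 1, y) \<or> i = x - 1 \<and> j = y - 1" for i j
        using F by (auto simp: Q)
      have VT: "V i j \<in> ?T \<Longrightarrow> V i j \<in> T \<and> (i, j) \<noteq> (x, y - 1) \<or> i = x - 1 \<and> j = y - 1" for i j
        using F by (auto simp: Q)
      have "bnd a M (int n) ?T"
        unfolding bnd_def
      proof (intro allI conjI impI)
        fix i j assume "H i j \<in> ?T"
        note e = HT[OF this]
        show "a \<le> i" "a \<le> j" "j < a + M" using e TH[of i j] TH[OF F(1)] TV[OF F(2)] by auto
        show "(i + 1 - a) * M + (j - a) < int n"
        proof (cases "i = x - 1 \<and> j = y - 1")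
          case True
          then show ?thesis using n by simp
        next
          case False
          then show ?thesis using e rank[of "i + 1" j] TH[of i j] by (auto simp: less_le)
        qed
      next
        fix i j assume "V i j \<in> ?T"
        note e = VT[OF this]
        show "a \<le> i" "a \<le> j" "j + 1 < a + M" using e TV[of i j] TH[OF F(1)] TV[OF F(2)] y by auto
        show "(i - a) * M + (j + 1 - a) < int n"
        proof (cases "i = x - 1 \<and> j = y - 1")
          case True
          then show ?thesis using n \<open>M > 0\<close> by (simp add: algebra_simps)
        next
          case False
          then show ?thesis using e rank[of i "j + 1"] TV[of i j] by (auto simp: less_le)
        qed
      qed
      moreover have fT: "finite ?T" using Suc.prems(1) by (simp add: Q)
      moreover have "even (card (?T \<inter> cross i j))" for i j
        using even_card_sym_diff[of T Q "cross i j"] Suc.prems(1,2) even_card_square_cross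
        by (simp add: Q_def finite_square)
      ultimately have "P ?T" using Suc.IH Suc.prems(4) by blast
      \<comment> \<open>Adding the same square again recovers \<open>T\<close>.\<close>
      then have "P (sym_diff ?T (square (x - 1) (y - 1)))" by (intro square fT)
      moreover have "sym_diff ?T (square (x - 1) (y - 1)) = T" by (auto simp: Q_def)
      ultimately show ?thesis by simp
    qed
  qed
  define A where "A = case_prod H -` T \<union> case_prod V -` T"
  define I where "I = fst ` A \<union> snd ` A"
  have "inj (case_prod H)" "inj (case_prod V)" by (auto simp: inj_def)
  then have "finite I"
    unfolding I_def A_def by (intro finite_UnI finite_imageI finite_vimageI assms(1))
  then obtain b where b: "\<And>i. i \<in> I \<Longrightarrow> \<bar>i\<bar> \<le> b"
    using finite_imageI[of I abs] by (metis Max_ge imageI)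
  \<comment> \<open>The box needs room for coordinates up to \<open>\<bar>b\<bar> + 1\<close>, as
    endpoints are shifted by one; the absolute value covers an empty \<open>I\<close>, where
    \<open>b\<close> may be negative. All ranks lie below the square of the side length.\<close>
  have bnd: "bnd (- \<bar>b\<bar>) (2 * \<bar>b\<bar> + 2) (int (nat ((2 * \<bar>b\<bar> + 2) * (2 * \<bar>b\<bar> + 2)))) T"
  proof -
    let ?M = "2 * \<bar>b\<bar> + 2"
    have step: "p * ?M + q < ?M * ?M" if "p \<le> ?M - 1" "q < ?M" for p q
    proof -
      have "p * ?M \<le> (?M - 1) * ?M" using that(1) by (intro mult_right_mono) auto
      then show ?thesis using that(2) by (simp add: algebra_simps)
    qed
    show ?thesis
      unfolding bnd_def
    proof (intro allI conjI impI)
      fix i j assume "H i j \<in> T"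
      then have "(i, j) \<in> A" by (simp add: A_def)
      then have "i \<in> I" "j \<in> I" unfolding I_def by (auto intro: rev_image_eqI)
      with b[of i] b[of j] have ij: "\<bar>i\<bar> \<le> \<bar>b\<bar>" "\<bar>j\<bar> \<le> \<bar>b\<bar>" by auto
      then show "- \<bar>b\<bar> \<le> i" "- \<bar>b\<bar> \<le> j" "j < - \<bar>b\<bar> + ?M" by auto
      show "(i + 1 - - \<bar>b\<bar>) * ?M + (j - - \<bar>b\<bar>) < int (nat (?M * ?M))"
        using step[of "i + 1 - - \<bar>b\<bar>" "j - - \<bar>b\<bar>"] ij by simp
    next
      fix i j assume "V i j \<in> T"
      then have "(i, j) \<in> A" by (simp add: A_def)
      then have "i \<in> I" "j \<in> I" unfolding I_def by (auto intro: rev_image_eqI)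
      with b[of i] b[of j] have ij: "\<bar>i\<bar> \<le> \<bar>b\<bar>" "\<bar>j\<bar> \<le> \<bar>b\<bar>" by auto
      then show "- \<bar>b\<bar> \<le> i" "- \<bar>b\<bar> \<le> j" "j + 1 < - \<bar>b\<bar> + ?M" by auto
      show "(i - - \<bar>b\<bar>) * ?M + (j + 1 - - \<bar>b\<bar>) < int (nat (?M * ?M))"
        using step[of "i - - \<bar>b\<bar>" "j + 1 - - \<bar>b\<bar>"] ij by simp
    qed
  qed
  show ?thesis by (rule main[OF assms(1,2) bnd]) simp
qed

end

section \<open>The planar lattice and its dual as grids\<close>

interpretation lattice: square_grid "\<lambda>i j. edge (i, j) (i + 1, j)" "\<lambda>i j. edge (i, j) (i, j + 1)"
proof
  fix e
  obtain u v where uv: "adjacent u v" "endpoints e = {u, v}" "e = edge u v" by (rule edge_cases)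
  obtain i j k l where ij: "u = (i, j)" "v = (k, l)" by (cases u, cases v)
  have "v = (i + 1, j) \<or> v = (i, j + 1) \<or> u = (k + 1, l) \<or> u = (k, l + 1)"
    using uv(1) unfolding ij adjacent_def by simp presburger
  moreover have "edge u v = edge v u" by (simp add: edge_def insert_commute)
  ultimately show "(\<exists>i j. e = edge (i, j) (i + 1, j)) \<or> (\<exists>i j. e = edge (i, j) (i, j + 1))"
    using uv(3) ij by metis
qed (auto simp: edge_eq_iff adjacent_def doubleton_eq_iff)

text \<open>Reflection in the origin together with exchange of the two edge directions swaps stars and
  faces.\<close>

interpretation dual: square_grid
  "\<lambda>i j. edge (- i, - j) (- i, - j + 1)" "\<lambda>i j. edge (- i, - j) (- i + 1, - j)"
proof
  fix e
  show "(\<exists>i j. e = edge (- i, - j) (- i, - j + 1)) \<or> (\<exists>i j. e = edge (- i, - j) (- i + 1, - j))"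
    using lattice.edge_exhaust[of e] by (metis minus_minus)
qed (auto simp: edge_eq_iff adjacent_def doubleton_eq_iff)

lemma lattice_cross: "lattice.cross i j = star_edges (i, j)"
  by (simp add: lattice.cross_def star_edges_eq)

lemma lattice_square: "lattice.square i j = face_edges (i, j)"
  by (simp add: lattice.square_def face_edges_eq insert_commute)

lemma dual_cross: "dual.cross i j = face_edges (- i, - j)"
  unfolding dual.cross_def face_edges_eq by (auto simp: algebra_simps)

lemma dual_square: "dual.square i j = star_edges (- i, - j)"
proof -
  have *: "- (i + 1) = - i - 1" "- (j + 1) = - j - 1" by simp_all
  show ?thesis
    unfolding dual.square_def star_edges_eq * by (simp add: insert_commute)
qed

section \<open>Pauli words\<close>

lemma of_pre_one: "of_pre 1 = 1"
  by transfer simp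

lemma of_pre_add: "of_pre (a + b) = of_pre a + of_pre b"
  by transfer simp

lemma of_pre_uminus: "of_pre (- a) = - of_pre a"
  by transfer simp

lemma of_pre_scaleC: "of_pre (c *\<^sub>C a) = c *\<^sub>C of_pre a"
  by transfer simp

lemma of_pre_adj: "of_pre (adj a) = adj (of_pre a)"
  by transfer simp

lemma pauli_sigma_sq: "pauli sigma_x e * pauli sigma_x e = 1" "pauli sigma_z e * pauli sigma_z e = 1"
  by (simp_all add: pauli_def site_op_sigma_sq of_pre_one flip: of_pre_mult)

lemma adj_pauli_sigma:
  "adj (pauli sigma_x e) = pauli sigma_x e" "adj (pauli sigma_z e) = pauli sigma_z e"
  by (simp_all add: pauli_def adj_site_op_sigma flip: of_pre_adj)

lemma pauli_sigma_anticommute: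
  "pauli sigma_z f * pauli sigma_x e =
    (if e = f then - (pauli sigma_x e * pauli sigma_z f) else pauli sigma_x e * pauli sigma_z f)"
  by (auto simp: pauli_def site_op_sigma_anticommute of_pre_uminus site_op_commute[of f e]
      simp flip: of_pre_mult)

text \<open>\<open>local_alg_induct\<close> puts every local element into \<open>L\<close>, and
  local elements are dense. It serves both the span of the words and the algebra generated by the
  normalizers.\<close>

lemma closure_pauli_generated:
  fixes L :: "'e quasi_local set"
  assumes "1 \<in> L" "\<And>x y. x \<in> L \<Longrightarrow> y \<in> L \<Longrightarrow> x + y \<in> L" "\<And>c x. x \<in> L \<Longrightarrow> c *\<^sub>C x \<in> L"
    "\<And>e x. x \<in> L \<Longrightarrow> pauli sigma_x e * x \<in> L" "\<And>e x. x \<in> L \<Longrightarrow> pauli sigma_z e * x \<in> L"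
  shows "closure L = UNIV"
proof -
  have L: "of_pre a \<in> L" for a
    by (induction a rule: local_alg_induct)
      (use assms in \<open>simp_all add: of_pre_one of_pre_add of_pre_scaleC of_pre_mult flip: pauli_def\<close>)
  have "x \<in> closure L" for x
    unfolding closure_approachable
  proof (intro allI impI)
    fix e :: real assume "e > 0"
    then obtain a where "norm (x - of_pre a) < e" using of_pre_dense by blast
    with L show "\<exists>y\<in>L. dist y x < e" by (auto simp: dist_norm norm_minus_commute)
  qed
  then show ?thesis by auto
qed

section \<open>Products of Pauli matrices over finite sets of edges\<close>

abbreviation x_prod :: "'e set \<Rightarrow> 'e quasi_local"
  where "x_prod \<equiv> comm_prod (pauli sigma_x)"

abbreviation z_prod :: "'e set \<Rightarrow> 'e quasi_local"
  where "z_prod \<equiv> comm_prod (pauli sigma_z)"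

lemmas x_prod_mult = comm_prod_mult[of "pauli sigma_x", OF pauli_commute pauli_sigma_sq(1)]
lemmas z_prod_mult = comm_prod_mult[of "pauli sigma_z", OF pauli_commute pauli_sigma_sq(2)]
lemmas x_prod_single = comm_prod_single[of "pauli sigma_x", OF pauli_commute pauli_sigma_sq(1)]
lemmas z_prod_single = comm_prod_single[of "pauli sigma_z", OF pauli_commute pauli_sigma_sq(2)]
lemmas x_prod_commute = comm_prod_commute[of "pauli sigma_x", OF pauli_commute pauli_sigma_sq(1)]
lemmas z_prod_commute = comm_prod_commute[of "pauli sigma_z", OF pauli_commute pauli_sigma_sq(2)]
lemmas x_prod_sq = comm_prod_sq[of "pauli sigma_x", OF pauli_commute pauli_sigma_sq(1)]
lemmas z_prod_sq = comm_prod_sq[of "pauli sigma_z", OF pauli_commute pauli_sigma_sq(2)]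
lemmas adj_x_prod =
  adj_comm_prod[of "pauli sigma_x", OF pauli_commute pauli_sigma_sq(1) adj_pauli_sigma(1)]
lemmas adj_z_prod =
  adj_comm_prod[of "pauli sigma_z", OF pauli_commute pauli_sigma_sq(2) adj_pauli_sigma(2)]
lemmas z_prod_x_prod = comm_prod_anticommute[of "pauli sigma_x" "pauli sigma_z",
    OF pauli_commute pauli_commute pauli_sigma_anticommute]

text \<open>The factor \<open>x_prod A\<close> commutes with \<open>x_prod S\<close> and passes
  \<open>z_prod T\<close> at the cost of one sign per common edge. With \<open>A\<close> a star, the
  sign tells whether \<open>T\<close> meets it evenly.\<close>

lemma x_prod_conj:
  assumes "finite A" "finite S" "finite T"
  shows "x_prod A * (x_prod S * z_prod T) * x_prod A =
    (if even (card (A \<inter> T)) then x_prod S * z_prod T else - (x_prod S * z_prod T))"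
proof -
  have "x_prod A * (x_prod S * z_prod T) * x_prod A = x_prod S * x_prod A * (z_prod T * x_prod A)"
    by (simp add: x_prod_commute[OF assms(2,1)] mult.assoc)
  also have "\<dots> = (if even (card (A \<inter> T)) then x_prod S * (x_prod A * x_prod A) * z_prod T
      else - (x_prod S * (x_prod A * x_prod A) * z_prod T))"
    by (simp add: z_prod_x_prod[OF assms(1,3)] mult.assoc)
  finally show ?thesis by (simp add: x_prod_sq[OF assms(1)])
qed

lemma z_prod_conj:
  assumes "finite B" "finite S" "finite T"
  shows "z_prod B * (x_prod S * z_prod T) * z_prod B =
    (if even (card (S \<inter> B)) then x_prod S * z_prod T else - (x_prod S * z_prod T))"
proof -
  have "z_prod B * (x_prod S * z_prod T) * z_prod B = z_prod B * x_prod S * (z_prod B * z_prod T)"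
    by (simp add: z_prod_commute[OF assms(1,3)] mult.assoc)
  also have "\<dots> = (if even (card (S \<inter> B)) then x_prod S * (z_prod B * z_prod B) * z_prod T
      else - (x_prod S * (z_prod B * z_prod B) * z_prod T))"
    by (simp add: z_prod_x_prod[OF assms(2,1)] mult.assoc)
  finally show ?thesis by (simp add: z_prod_sq[OF assms(1)])
qed

text \<open>Complex multiples are included because \<open>span\<close> is the real span.\<close>

definition pauli_words :: "'e quasi_local set"
  where "pauli_words = {c *\<^sub>C (x_prod S * z_prod T) |c S T. finite S \<and> finite T}"

lemma linear_span_mem:
  assumes "linear f" "f ` S \<subseteq> S" "x \<in> span S"
  shows "f x \<in> span S"
proof -
  have "f x \<in> span (f ` S)" using assms(1,3) by (auto simp: linear_span_image)
  then show ?thesis using span_mono[OF assms(2)] by blast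
qed

lemma closure_span_pauli_words: "closure (span (pauli_words :: 'e quasi_local set)) = UNIV"
proof (rule closure_pauli_generated)
  let ?W = "pauli_words :: 'e quasi_local set"
  have "1 *\<^sub>C (x_prod {} * z_prod {}) \<in> ?W" unfolding pauli_words_def by blast
  then show "1 \<in> span ?W" by (simp add: comm_prod_empty scaleC_one span_base)
  show "x + y \<in> span ?W" if "x \<in> span ?W" "y \<in> span ?W" for x y using that by (rule span_add)
  have word: "c *\<^sub>C (x_prod S * z_prod T) \<in> ?W" if "finite S" "finite T" for c S T
    using that unfolding pauli_words_def by blast
  have wordE: "\<exists>c S T. w = c *\<^sub>C (x_prod S * z_prod T) \<and> finite S \<and> finite T" if "w \<in> ?W" for w
    using that unfolding pauli_words_def by blast
  have "c *\<^sub>C w \<in> ?W" if "w \<in> ?W" for c w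
    using wordE[OF that] by (auto simp: scaleC_scaleC intro: word)
  then have "(\<lambda>x. c *\<^sub>C x) ` ?W \<subseteq> ?W" for c by blast
  then show "c *\<^sub>C x \<in> span ?W" if "x \<in> span ?W" for c x
    using that by (rule linear_span_mem[OF linear_scaleC])
  have x: "pauli sigma_x e * (c *\<^sub>C (x_prod S * z_prod T)) = c *\<^sub>C (x_prod (sym_diff {e} S) * z_prod T)"
    if "finite S" for e :: 'e and c S T
    using x_prod_mult[of "{e}" S] that by (simp add: x_prod_single mult_scaleC_right flip: mult.assoc)
  have "pauli sigma_x e * w \<in> ?W" if W: "w \<in> ?W" for e w
  proof -
    obtain c S T where w: "w = c *\<^sub>C (x_prod S * z_prod T)" "finite S" "finite T"
      using wordE[OF W] by blast
    show ?thesis unfolding w(1) x[OF w(2)] by (rule word) (use w in auto)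
  qed
  then have "(\<lambda>x. pauli sigma_x e * x) ` ?W \<subseteq> ?W" for e by blast
  then show "pauli sigma_x e * x \<in> span ?W" if "x \<in> span ?W" for e x
    using that by (rule linear_span_mem[OF bounded_linear.linear[OF bounded_linear_mult_right]])
  \<comment> \<open>The scalar \<open>d\<close> absorbs the sign that arises when the new factor is
    moved past \<open>x_prod S\<close>.\<close>
  have z: "\<exists>d. pauli sigma_z e * (c *\<^sub>C (x_prod S * z_prod T)) = d *\<^sub>C (x_prod S * z_prod (sym_diff {e} T))"
    if "finite S" "finite T" for e :: 'e and c S T
  proof -
    have "pauli sigma_z e * (x_prod S * z_prod T) = z_prod {e} * x_prod S * z_prod T"
      by (simp add: z_prod_single mult.assoc)
    also have "\<dots> = (if e \<in> S then - 1 else 1) *\<^sub>C (x_prod S * (z_prod {e} * z_prod T))"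
      using scaleR_eq_scaleC[of "- 1" "x_prod S * (z_prod {e} * z_prod T)"]
      by (simp add: z_prod_x_prod that(1) mult.assoc scaleC_one)
    finally show ?thesis
      by (auto simp: mult_scaleC_right z_prod_mult that(2) scaleC_scaleC)
  qed
  have "pauli sigma_z e * w \<in> ?W" if W: "w \<in> ?W" for e w
  proof -
    obtain c S T where w: "w = c *\<^sub>C (x_prod S * z_prod T)" "finite S" "finite T"
      using wordE[OF W] by blast
    obtain d where d: "pauli sigma_z e * w = d *\<^sub>C (x_prod S * z_prod (sym_diff {e} T))"
      using z[OF w(2,3)] w(1) by blast
    show ?thesis unfolding d by (rule word) (use w in auto)
  qed
  then have "(\<lambda>x. pauli sigma_z e * x) ` ?W \<subseteq> ?W" for e by blast
  then show "pauli sigma_z e * x \<in> span ?W" if "x \<in> span ?W" for e x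
    using that by (rule linear_span_mem[OF bounded_linear.linear[OF bounded_linear_mult_right]])
qed

section \<open>The algebra of star and face operators\<close>

lemma finite_star_edges: "finite (star_edges v)"
  by (cases v) (simp add: star_edges_eq)

lemma finite_face_edges: "finite (face_edges p)"
  by (cases p) (simp add: face_edges_eq)

lemma even_card_star_face: "even (card (star_edges v \<inter> face_edges p))"
  using lattice.even_card_square_cross[of "fst p" "snd p" "fst v" "snd v"]
  by (simp add: lattice_cross lattice_square Int_commute)

lemma star_op_face_op_commute: "face_op p * star_op v = star_op v * face_op p"
  unfolding star_op_def face_op_def
  by (simp add: z_prod_x_prod finite_star_edges finite_face_edges even_card_star_face)

text \<open>\<open>lattice.even_induct\<close> builds \<open>T\<close> from faces by symmetric
  differences, and each face contributes a factor \<open>face_op\<close>.\<close>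

lemma z_prod_mem:
  assumes "finite T" "\<And>v. even (card (T \<inter> star_edges v))"
  shows "z_prod T \<in> cstar_generated (range star_op \<union> range face_op)" (is "_ \<in> ?C")
proof -
  have face: "face_op p \<in> ?C" for p
    using cstar_generated_superset[of "range star_op \<union> range face_op"] by auto
  have mult: "x * y \<in> ?C" if "x \<in> ?C" "y \<in> ?C" for x y
    using that by (rule sub_cstar_algebraD(3)[OF sub_cstar_algebra_cstar_generated])
  have "even (card (T \<inter> lattice.cross i j))" for i j
    by (simp add: lattice_cross assms(2))
  with assms(1) show ?thesis
  proof (induction T rule: lattice.even_induct)
    case empty
    \<comment> \<open>\<open>sub_cstar_algebra\<close> does not ask for a unit, so 1 is obtained as
      the square of a generator.\<close>
    have "face_op undefined * face_op undefined \<in> ?C" by (intro mult face)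
    then show ?case by (simp add: face_op_def z_prod_sq finite_face_edges comm_prod_empty)
  next
    case (square T i j)
    have "z_prod T * face_op (i, j) \<in> ?C" by (intro mult face square)
    then show ?case
      unfolding face_op_def by (simp only: z_prod_mult square finite_face_edges lattice_square)
  qed
qed

text \<open>In the dual grid crosses are faces and squares are stars, so the same induction builds
  \<open>S\<close> from stars.\<close>

lemma x_prod_mem:
  assumes "finite S" "\<And>p. even (card (S \<inter> face_edges p))"
  shows "x_prod S \<in> cstar_generated (range star_op \<union> range face_op)" (is "_ \<in> ?C")
proof -
  have star: "star_op v \<in> ?C" for v
    using cstar_generated_superset[of "range star_op \<union> range face_op"] by auto
  have mult: "x * y \<in> ?C" if "x \<in> ?C" "y \<in> ?C" for x y
    using that by (rule sub_cstar_algebraD(3)[OF sub_cstar_algebra_cstar_generated])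
  have "even (card (S \<inter> dual.cross i j))" for i j
    unfolding dual_cross by (rule assms(2))
  with assms(1) show ?thesis
  proof (induction S rule: dual.even_induct)
    case empty
    have "star_op undefined * star_op undefined \<in> ?C" by (intro mult star)
    then show ?case by (simp add: star_op_def x_prod_sq finite_star_edges comm_prod_empty)
  next
    case (square S i j)
    have "x_prod S * star_op (- i, - j) \<in> ?C" by (intro mult star square)
    then show ?case
      unfolding star_op_def by (simp only: x_prod_mult square finite_star_edges dual_square)
  qed
qed

lemma pauli_sigma_normalizer:
  assumes "m = sigma_x \<or> m = sigma_z"
  shows "pauli m e \<in> normalizers (cstar_generated (range star_op \<union> range face_op))"
proof (rule normalizers_cstar_generatedI)
  show "adj (pauli m e) = pauli m e" "pauli m e * pauli m e = 1"
    using assms by (auto simp: adj_pauli_sigma pauli_sigma_sq)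
  fix s assume "s \<in> range star_op \<union> range face_op"
  \<comment> \<open>Every generator is a word with one of its two factors empty, so the conjugation
    rules for words apply.\<close>
  then obtain S T where "s = x_prod S * z_prod T" "finite S" "finite T"
    using finite_star_edges finite_face_edges
    by (metis UnE comm_prod_empty face_op_def finite.emptyI imageE mult.left_neutral mult.right_neutral star_op_def)
  then show "pauli m e * s * pauli m e = s \<or> pauli m e * s * pauli m e = - s"
    using assms x_prod_conj[of "{e}" S T] z_prod_conj[of "{e}" S T]
    by (auto simp: x_prod_single z_prod_single split: if_splits)
qed

theorem proposition3p2:
  shows "regular_masa (cstar_generated (range star_op \<union> range face_op))"
proof -
  let ?G = "range star_op \<union> range face_op"
  let ?C = "cstar_generated ?G"
  note C = sub_cstar_algebraD[OF sub_cstar_algebra_cstar_generated]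
  have "masa ?C"
  proof (rule masa_cstar_generatedI[OF _ _ closure_span_pauli_words])
    show "adj g = g \<and> g * g = 1" if "g \<in> ?G" for g
      using that by (auto simp: star_op_def face_op_def adj_x_prod adj_z_prod x_prod_sq z_prod_sq
        finite_star_edges finite_face_edges)
    show "g * h = h * g" if "g \<in> ?G" "h \<in> ?G" for g h
      using that star_op_face_op_commute x_prod_commute[OF finite_star_edges finite_star_edges]
        z_prod_commute[OF finite_face_edges finite_face_edges]
      unfolding star_op_def face_op_def by (elim UnE imageE) (simp_all only:)
    fix w :: "edge quasi_local" assume "w \<in> pauli_words"
    then obtain c S T where w: "w = c *\<^sub>C (x_prod S * z_prod T)" and fin: "finite S" "finite T"
      unfolding pauli_words_def by blast
    \<comment> \<open>An odd intersection with a star or a face yields a generator anticommuting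
      with \<open>w\<close>; otherwise both factors are products of generators.\<close>
    consider v where "odd (card (T \<inter> star_edges v))" | p where "odd (card (S \<inter> face_edges p))"
      | "\<And>v. even (card (T \<inter> star_edges v))" "\<And>p. even (card (S \<inter> face_edges p))"
      by blast
    then show "w \<in> ?C \<or> (\<exists>g\<in>?G. g * w * g = - w)"
    proof cases
      case 1
      then have "star_op v * w * star_op v = - w"
        using x_prod_conj[OF finite_star_edges fin, of v] linear_neg[OF linear_scaleC, of c]
        by (simp add: w star_op_def mult_scaleC_left mult_scaleC_right Int_commute)
      then show ?thesis by blast
    next
      case 2
      then have "face_op p * w * face_op p = - w"
        using z_prod_conj[OF finite_face_edges fin, of p] linear_neg[OF linear_scaleC, of c]
        by (simp add: w face_op_def mult_scaleC_left mult_scaleC_right)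
      then show ?thesis by blast
    next
      case 3
      then have "w \<in> ?C"
        unfolding w by (intro C(3,4) x_prod_mem z_prod_mem fin)
      then show ?thesis ..
    qed
  qed
  moreover have "cstar_generated (normalizers ?C) = UNIV"
  proof -
    let ?N = "cstar_generated (normalizers ?C)"
    have N: "pauli sigma_x e \<in> ?N" "pauli sigma_z e \<in> ?N" for e
      using pauli_sigma_normalizer[of _ e] cstar_generated_superset by blast+
    \<comment> \<open>Again the unit arises as a square; \<open>closure_pauli_generated\<close>
      needs it as its starting point.\<close>
    have "pauli sigma_x undefined * pauli sigma_x undefined \<in> ?N" by (intro C(3) N)
    then have "closure ?N = UNIV"
      by (intro closure_pauli_generated C(2-4) N) (simp_all add: pauli_sigma_sq)
    then show ?thesis by (simp only: closure_closed[OF C(6)])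
  qed
  ultimately show ?thesis by (simp add: regular_masa_def)
qed

end
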